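(* Let $u=(u_0,u_1,u_2,u_3)^T$ be a parametrized non-radial curve in the upper light cone (with $\|u'\|_J\neq 0$ and $u_3\neq 0$), let $\rho_L$ be the right moving frame along $u$ described in the context, and let $K_L=(\rho_L)_x\rho_L^{-1}$ be its right Maurer–Cartan matrix. Then $$K_L=\begin{pmatrix}0&-k_0&0&0\\-k_1&0&0&-k_0\\-k_2&0&0&0\\0&-k_1&-k_2&0\end{pmatrix},$$ where $$k_0=\|u'\|_J,\qquad k_1=\frac{-\|u''\|_J^2\,\|u'\|_J^2+\langle u',u''\rangle_J^2}{2\|u'\|_J^4},$$ $$k_2=\frac{1}{u_3\|u'\|_J^2}\det(u,u',u''')+3\,\frac{\langle u',u''\rangle_J}{u_3\|u'\|_J^3}\det(u,u',u'').$$ The invariants $k_0,k_1,k_2$ and their derivatives functionally generate any other invariant for curves in the light cone under the centro-affine (linear) action of the Lorentzian group.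
   Context: Coordinates on $\mathbb{R}^4$ are $(u_0,u_1,u_2,u_3)$, with standard basis $e_1,e_2,e_3,e_4$ (so $e_4=(0,0,0,1)^T$). Set $$J=\begin{pmatrix}0&0&0&-1\\0&1&0&0\\0&0&1&0\\-1&0&0&0\end{pmatrix},$$ $\langle u,v\rangle_J=u^TJv$, $\|u\|_J^2=\langle u,u\rangle_J$. The Lorentzian group is $O(3,1)=\{\Theta\in GL(4,\mathbb{R}):\Theta^TJ\Theta=J\}$, and the light cone is $C_L=\{u:\langle u,u\rangle_J=0\}$, on which $O(3,1)$ acts linearly. Curves are parametrized by $x$, the prime and the subscript $x$ denote $d/dx$, and the group does not act on $x$. A curve is called non-radial (star-shaped) if $u'$ is never in the radial direction of the cone; this holds when $\|u'\|_J\ne0$. For $a,b,c\in\mathbb{R}^4$, $\det(a,b,c)$ denotes the $3\times3$ determinant with rows $(a_1,a_2,a_3),(b_1,b_2,b_3),(c_1,c_2,c_3)$ (the component of index $0$ is dropped). Right moving frame: $\rho_L=\rho_L(x)\in O(3,1)$ is the element of the form $$g=\begin{pmatrix}1&0&0\\ \xi&I&0\\ \frac12\|\xi\|^2&\xi^T&1\end{pmatrix}\begin{pmatrix}\alpha&0&0\\0&A&0\\0&0&\alpha^{-1}\end{pmatrix}\begin{pmatrix}1&v^T&\frac12\|v\|^2\\0&I&v\\0&0&1\end{pmatrix},\qquad \xi,v\in\mathbb{R}^2,$$ with $A$ a rotation, determined by the normalization equations $gu=e_4$, $gu'=\|u'\|_J\,e_2$, and third component of $gu''$ equal to $0$. In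 particular $v=-\hat u/u_3$ with $\hat u=(u_1,u_2)^T$, and $\alpha=u_3$. A differential invariant is a (locally defined) function of the curve and its derivatives up to some finite order that is invariant under the prolonged action of the group.
   Formalization: Printed k_1, k_2 do not fit the matrix unless ‖u'‖_J=1: k_1 has denominator 2‖u'‖_J^5; k_2 has ‖u'‖_J^3 in the first term and a minus sign and ‖u'‖_J^5 in the second. Invariance is for group elements near the identity, as k_2 changes sign under a reflection. *)

theory Defs
  imports "HOL-Analysis.Analysis"
begin

(* The coordinates (u_0,u_1,u_2,u_3) are the components u $ 1, u $ 2, u $ 3, u $ 4 of a vector
   in real^4, so that the basis vector e_i is axis i 1. *)

section \<open>Lorentzian geometry\<close>

definition J :: "real^4^4" where
  "J = vector [vector [ 0, 0, 0, -1],
               vector [ 0, 1, 0,  0],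
               vector [ 0, 0, 1,  0],
               vector [-1, 0, 0,  0]]"

definition ipJ :: "real^4 \<Rightarrow> real^4 \<Rightarrow> real" where
  "ipJ u v = u \<bullet> (J *v v)"

definition normJ :: "real^4 \<Rightarrow> real" where
  "normJ u = sqrt (ipJ u u)"

definition O31 :: "(real^4^4) set" where
  "O31 = {\<Theta>. invertible \<Theta> \<and> transpose \<Theta> ** J ** \<Theta> = J}"

definition light_cone :: "(real^4) set" where
  "light_cone = {u. ipJ u u = 0}"

(* u_0 + u_3 is (up to a positive factor) the time coordinate of the form
   -2 u_0 u_3 + u_1^2 + u_2^2. *)
definition upper_light_cone :: "(real^4) set" where
  "upper_light_cone = {u \<in> light_cone. u $ 1 + u $ 4 > 0}"

definition det3 :: "real^4 \<Rightarrow> real^4 \<Rightarrow> real^4 \<Rightarrow> real" where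
  "det3 a b c = det (vector [vector [a $ 2, a $ 3, a $ 4],
                             vector [b $ 2, b $ 3, b $ 4],
                             vector [c $ 2, c $ 3, c $ 4]] :: real^3^3)"

section \<open>Curves and their jets\<close>

definition nderiv :: "nat \<Rightarrow> (real \<Rightarrow> 'a::real_normed_vector) \<Rightarrow> real \<Rightarrow> 'a" where
  "nderiv n f = ((\<lambda>h x. vector_derivative h (at x)) ^^ n) f"

definition smooth_curve_on :: "real set \<Rightarrow> (real \<Rightarrow> 'a::real_normed_vector) \<Rightarrow> bool" where
  "smooth_curve_on S f \<longleftrightarrow> (\<forall>n. \<forall>x\<in>S. nderiv n f differentiable (at x))"

definition nonradial_curve :: "real set \<Rightarrow> (real \<Rightarrow> real^4) \<Rightarrow> bool" where
  "nonradial_curve S u \<longleftrightarrow>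
     open S \<and> smooth_curve_on S u \<and>
     (\<forall>x\<in>S. u x \<in> upper_light_cone \<and> u x $ 4 \<noteq> 0 \<and>
            normJ (vector_derivative u (at x)) \<noteq> 0)"

(* A jet z lists the derivatives of the curve: z 0 = u, z 1 = u', z 2 = u'', ...  The parameter x
   is not part of the jet. *)
type_synonym jet = "nat \<Rightarrow> real^4"

definition jet_of :: "(real \<Rightarrow> real^4) \<Rightarrow> real \<Rightarrow> jet" where
  "jet_of u x = (\<lambda>n. nderiv n u x)"

definition jet_space :: "jet set" where
  "jet_space = {jet_of u x | u S x. nonradial_curve S u \<and> x \<in> S}"

(* The action on curves is linear and does not involve x, so the prolonged action is the linear
   action on every derivative. *)
definition prolong :: "real^4^4 \<Rightarrow> jet \<Rightarrow> jet" where
  "prolong g z = (\<lambda>n. g *v z n)"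

section \<open>The right moving frame and its Maurer-Cartan matrix\<close>

definition lower_factor :: "real^2 \<Rightarrow> real^4^4" where
  "lower_factor \<xi> = vector [vector [1, 0, 0, 0],
                           vector [\<xi> $ 1, 1, 0, 0],
                           vector [\<xi> $ 2, 0, 1, 0],
                           vector [(norm \<xi>)\<^sup>2 / 2, \<xi> $ 1, \<xi> $ 2, 1]]"

definition diag_factor :: "real \<Rightarrow> real^2^2 \<Rightarrow> real^4^4" where
  "diag_factor \<alpha> A = vector [vector [\<alpha>, 0, 0, 0],
                            vector [0, A $ 1 $ 1, A $ 1 $ 2, 0],
                            vector [0, A $ 2 $ 1, A $ 2 $ 2, 0],
                            vector [0, 0, 0, inverse \<alpha>]]"

definition upper_factor :: "real^2 \<Rightarrow> real^4^4" where
  "upper_factor v = vector [vector [1, v $ 1, v $ 2, (norm v)\<^sup>2 / 2],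
                           vector [0, 1, 0, v $ 1],
                           vector [0, 0, 1, v $ 2],
                           vector [0, 0, 0, 1]]"

definition frame_form :: "real^4^4 \<Rightarrow> bool" where
  "frame_form g \<longleftrightarrow>
     (\<exists>\<xi> \<alpha> A v. \<alpha> \<noteq> 0 \<and> rotation_matrix A \<and>
        g = lower_factor \<xi> ** diag_factor \<alpha> A ** upper_factor v)"

definition is_frame :: "jet \<Rightarrow> real^4^4 \<Rightarrow> bool" where
  "is_frame z g \<longleftrightarrow> g \<in> O31 \<and> frame_form g \<and>
     g *v z 0 = axis 4 1 \<and>
     g *v z 1 = normJ (z 1) *\<^sub>R axis 2 1 \<and>
     (g *v z 2) $ 3 = 0"

definition \<rho>\<^sub>L :: "(real \<Rightarrow> real^4) \<Rightarrow> real \<Rightarrow> real^4^4" where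
  "\<rho>\<^sub>L u x = (THE g. is_frame (jet_of u x) g)"

definition right_maurer_cartan :: "(real \<Rightarrow> real^4^4) \<Rightarrow> real \<Rightarrow> real^4^4" where
  "right_maurer_cartan \<rho> x = vector_derivative \<rho> (at x) ** matrix_inv (\<rho> x)"

section \<open>The generating invariants, as functions of the jet\<close>

definition k\<^sub>0 :: "jet \<Rightarrow> real" where
  "k\<^sub>0 z = normJ (z 1)"

(* The source prints the denominator 2 * normJ (z 1) ^ 4 in k_1, and in k_2 the denominators
   normJ (z 1) ^ 2 and normJ (z 1) ^ 3 and a plus sign between the two terms.  With those the
   Maurer-Cartan matrix is correct only when normJ (z 1) = 1 identically: under x -> c * x the
   entries of the matrix scale by c, so each term must have weight 1.  The exponents and the sign
   below are the ones that hold for every parametrization; the two versions agree when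
   normJ (z 1) = 1 identically. *)
definition k\<^sub>1 :: "jet \<Rightarrow> real" where
  "k\<^sub>1 z = (- (ipJ (z 2) (z 2)) * (normJ (z 1))\<^sup>2 + (ipJ (z 1) (z 2))\<^sup>2)
           / (2 * normJ (z 1) ^ 5)"

definition k\<^sub>2 :: "jet \<Rightarrow> real" where
  "k\<^sub>2 z = 1 / (z 0 $ 4 * normJ (z 1) ^ 3) * det3 (z 0) (z 1) (z 3)
         - 3 * (ipJ (z 1) (z 2) / (z 0 $ 4 * normJ (z 1) ^ 5)) * det3 (z 0) (z 1) (z 2)"

(* n-th entry: the n-th derivatives of the three invariants along the curve *)
definition invariant_jet :: "(real \<Rightarrow> real^4) \<Rightarrow> real \<Rightarrow> nat \<Rightarrow> real^3" where
  "invariant_jet u x = (\<lambda>n. nderiv n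
     (\<lambda>y. vector [k\<^sub>0 (jet_of u y), k\<^sub>1 (jet_of u y), k\<^sub>2 (jet_of u y)]) x)"

section \<open>Differential invariants and functional generation\<close>

definition finite_order_on :: "(nat \<Rightarrow> 'a) set \<Rightarrow> ((nat \<Rightarrow> 'a) \<Rightarrow> real) \<Rightarrow> bool" where
  "finite_order_on D f \<longleftrightarrow>
     (\<exists>N. \<forall>z\<in>D. \<forall>w\<in>D. (\<forall>n\<le>N. z n = w n) \<longrightarrow> f z = f w)"

(* Invariance of a locally defined function is tested for group elements near the identity.  (k_2
   changes sign under the reflection of the u_2 axis, which lies in O31, so it is invariant only in
   this sense.)  Sequences carry the product topology. *)
definition differential_invariant :: "jet set \<Rightarrow> (jet \<Rightarrow> real) \<Rightarrow> bool" where
  "differential_invariant D f \<longleftrightarrow>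
     openin (top_of_set jet_space) D \<and> finite_order_on D f \<and>
     (\<forall>z\<^sub>0\<in>D. \<exists>U V. open U \<and> z\<^sub>0 \<in> U \<and> open V \<and> mat 1 \<in> V \<and>
        (\<forall>g\<in>O31 \<inter> V. \<forall>z\<in>D \<inter> U. prolong g z \<in> D \<longrightarrow> f (prolong g z) = f z))"

definition partial :: "nat \<Rightarrow> 'a::euclidean_space \<Rightarrow> ((nat \<Rightarrow> 'a) \<Rightarrow> real) \<Rightarrow> (nat \<Rightarrow> 'a) \<Rightarrow> real" where
  "partial n b f z = deriv (\<lambda>t. f (z(n := z n + t *\<^sub>R b))) 0"

(* For open W, the usual condition that the partial derivatives up to order r exist and are
   continuous. *)
primrec Cr_on :: "nat \<Rightarrow> (nat \<Rightarrow> 'a::euclidean_space) set \<Rightarrow> ((nat \<Rightarrow> 'a) \<Rightarrow> real) \<Rightarrow> bool" where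
  "Cr_on 0 W f \<longleftrightarrow> continuous_on W f"
| "Cr_on (Suc r) W f \<longleftrightarrow> continuous_on W f \<and>
     (\<forall>n. \<forall>b\<in>Basis.
        (\<forall>z\<in>W. (\<lambda>t. f (z(n := z n + t *\<^sub>R b))) differentiable (at 0)) \<and>
        Cr_on r W (partial n b f))"

definition smooth_on :: "(nat \<Rightarrow> 'a::euclidean_space) set \<Rightarrow> ((nat \<Rightarrow> 'a) \<Rightarrow> real) \<Rightarrow> bool" where
  "smooth_on W f \<longleftrightarrow> (\<forall>r. Cr_on r W f)"

(* D is open in the jet space of the cone, not in the space of all sequences; smoothness means
   that f extends smoothly to an ambient neighbourhood of every point. *)
definition smooth_on_jets :: "jet set \<Rightarrow> (jet \<Rightarrow> real) \<Rightarrow> bool" where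
  "smooth_on_jets D f \<longleftrightarrow>
     (\<forall>z\<in>D. \<exists>W h. open W \<and> z \<in> W \<and> finite_order_on W h \<and> smooth_on W h \<and>
        (\<forall>w\<in>W \<inter> D. h w = f w))"

(* Near every point of D, f is a function of k_0, k_1, k_2 and finitely many of their derivatives,
   and that function can be taken smooth if f is smooth. *)
definition functionally_generated :: "jet set \<Rightarrow> (jet \<Rightarrow> real) \<Rightarrow> bool" where
  "functionally_generated D f \<longleftrightarrow>
     (\<forall>z\<^sub>0\<in>D. \<exists>U W F. open U \<and> z\<^sub>0 \<in> U \<and> open W \<and> finite_order_on W F \<and>
        (smooth_on_jets D f \<longrightarrow> smooth_on W F) \<and>
        (\<forall>S u x. nonradial_curve S u \<longrightarrow> x \<in> S \<longrightarrow> jet_of u x \<in> D \<inter> U \<longrightarrow>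
           invariant_jet u x \<in> W \<and> f (jet_of u x) = F (invariant_jet u x)))"

end

theory Submission
  imports Defs
begin

text \<open>
The frame acts on the jet \<open>z\<close> of the curve by \<open>g z\<^sub>0 = e\<^sub>4\<close>, \<open>g z\<^sub>1 = k\<^sub>0 e\<^sub>2\<close> and, because \<open>g\<close> is an
isometry, \<open>g z\<^sub>2 = (k\<^sub>0\<^sup>2, k\<^sub>0', 0, k\<^sub>0 k\<^sub>1)\<close> (lemma \<open>frame_on_jet\<close>).  These three values and
\<open>det g = 1\<close> determine \<open>g\<close>, which gives uniqueness and a closed formula for its rows; existence is
the explicit product of the three factors.  Differentiating the three identities along the
curve gives two columns and one more entry of the Maurer--Cartan matrix.  The matrix is skew for
the Lorentzian form, since the frame preserves it, so these entries determine all others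
(\<open>frame_structure_equation\<close>).  The third invariant appears as
\<open>det(z\<^sub>0, z\<^sub>1, z\<^sub>2, z\<^sub>3) / k\<^sub>0\<^sup>5\<close>, and the passage to the 3 by 3 determinants comes from the fact that
on the hyperplane orthogonal to \<open>z\<^sub>0\<close> the volume form obtained by inserting a transversal vector
\<open>p\<close> depends on \<open>p\<close> only through \<open>\<langle>p, z\<^sub>0\<rangle>\<close> (\<open>det4_independent\<close>).

For generation, the structure equation turns into the recursion
\<open>w\<^sub>n\<^sub>+\<^sub>1 = D w\<^sub>n - K w\<^sub>n\<close> for the normalized jet \<open>w\<^sub>n = g z\<^sub>n\<close>, with \<open>w\<^sub>0 = e\<^sub>4\<close>.  Hence every \<open>w\<^sub>n\<close> is a
universal polynomial in the invariants and their derivatives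
(\<open>frame_times_jet_eq_normal_form\<close>).  Given an invariant \<open>f\<close> and a base jet with frame \<open>g\<^sub>0\<close>, the
element \<open>g\<^sub>0\<^sup>-\<^sup>1 g\<close> is close to the identity for jets close to the base jet, so
\<open>f(z) = f(g\<^sub>0\<^sup>-\<^sup>1 g z) = f(g\<^sub>0\<^sup>-\<^sup>1 w)\<close>: the function sought is \<open>f\<close> composed with the polynomial map
\<open>\<kappa> \<mapsto> g\<^sub>0\<^sup>-\<^sup>1 w(\<kappa>)\<close>.  That it is smooth when \<open>f\<close> is smooth is the chain rule for functions of
finitely many jet coordinates (\<open>Cr_on_compose\<close>).
\<close>

section \<open>Calculus of functions of finite order on sequence spaces\<close>

lemma tendsto_coordinatewise:
  fixes f :: "'a \<Rightarrow> 'b \<Rightarrow> 'c::topological_space"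
  assumes "\<And>i. ((\<lambda>x. f x i) \<longlongrightarrow> l i) F"
  shows "(f \<longlongrightarrow> l) F"
  using assms limitin_componentwise[of "\<lambda>_. euclidean :: 'c topology" "UNIV::'b set" f l F]
  by (simp add: euclidean_product_topology)

lemma tendsto_upd_add:
  fixes z :: "nat \<Rightarrow> 'a::real_normed_vector"
  shows "((\<lambda>t. z(n := z n + t *\<^sub>R b)) \<longlongrightarrow> z) (nhds 0)"
proof (rule tendsto_coordinatewise)
  fix i
  have "((\<lambda>t. z n + t *\<^sub>R b) \<longlongrightarrow> z n + 0 *\<^sub>R b) (nhds 0)"
    by (intro tendsto_intros) (simp add: filterlim_ident)
  then show "((\<lambda>t. (z(n := z n + t *\<^sub>R b)) i) \<longlongrightarrow> z i) (nhds 0)"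
    by (cases "i = n") auto
qed

lemma eventually_upd_add:
  fixes z :: "nat \<Rightarrow> 'a::real_normed_vector"
  assumes "open W" "z \<in> W"
  shows "\<forall>\<^sub>F t in nhds 0. z(n := z n + t *\<^sub>R b) \<in> W"
  using topological_tendstoD[OF tendsto_upd_add assms] .

text \<open>The updated sequence occurs below the function variable, so unification with this rule is not
a pattern problem; it has to be applied to goals in which the function is concrete.\<close>

lemma partial_eqI:
  assumes "((\<lambda>t. f (z(n := z n + t *\<^sub>R b))) has_real_derivative D) (at 0)"
  shows "partial n b f z = D"
  using assms by (simp add: partial_def DERIV_imp_deriv)

lemma has_derivative_partial:
  assumes "(\<lambda>t. f (z(n := z n + t *\<^sub>R b))) differentiable (at 0)"
  shows "((\<lambda>t. f (z(n := z n + t *\<^sub>R b))) has_real_derivative partial n b f z) (at 0)"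
proof -
  obtain D where "((\<lambda>t. f (z(n := z n + t *\<^sub>R b))) has_real_derivative D) (at 0)"
    using assms real_differentiableE by blast
  with partial_eqI show ?thesis by metis
qed

lemma Cr_on_derivative:
  assumes "Cr_on (Suc r) W f" "z \<in> W" "b \<in> Basis"
  shows "((\<lambda>t. f (z(n := z n + t *\<^sub>R b))) has_real_derivative partial n b f z) (at 0)"
  using assms by (intro has_derivative_partial) auto

lemma Cr_on_continuous: "Cr_on r W f \<Longrightarrow> continuous_on W f"
  by (cases r) auto

lemma Cr_on_SucI:
  assumes "continuous_on W f"
    and "\<And>n b z. b \<in> Basis \<Longrightarrow> z \<in> W \<Longrightarrow>
      ((\<lambda>t. f (z(n := z n + t *\<^sub>R b))) has_real_derivative g n b z) (at 0)"
    and "\<And>n b. b \<in> Basis \<Longrightarrow> Cr_on r W (partial n b f)"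
  shows "Cr_on (Suc r) W f"
  using assms by (auto simp: real_differentiable_def)

lemma Cr_on_cong:
  assumes "open W" "\<And>z. z \<in> W \<Longrightarrow> f z = g z" "Cr_on r W f"
  shows "Cr_on r W g"
  using assms(2,3)
proof (induction r arbitrary: f g)
  case 0
  then show ?case by (metis Cr_on.simps(1) continuous_on_eq)
next
  case (Suc r)
  have ev: "\<forall>\<^sub>F t in nhds 0. f (z(n := z n + t *\<^sub>R b)) = g (z(n := z n + t *\<^sub>R b))"
    if "z \<in> W" for z n and b :: 'a
    using eventually_upd_add[OF \<open>open W\<close> that, of n b] by eventually_elim (rule Suc.prems(1))
  have der: "((\<lambda>t. g (z(n := z n + t *\<^sub>R b))) has_real_derivative partial n b f z) (at 0)"
    if "z \<in> W" "b \<in> Basis" for z n b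
    using Cr_on_derivative[OF Suc.prems(2) that, of n] DERIV_cong_ev[OF refl ev[OF that(1)] refl]
    by blast
  have par: "partial n b f z = partial n b g z" if "b \<in> Basis" "z \<in> W" for z n b
    by (rule sym, rule partial_eqI) (rule der[OF that(2,1)])
  show ?case
  proof (rule Cr_on_SucI)
    show "continuous_on W g"
      using Suc.prems by (metis Cr_on_continuous continuous_on_eq)
    show "Cr_on r W (partial n b g)" if "b \<in> Basis" for n b
      using Suc.prems(2) that by (intro Suc.IH[OF par[OF that]]) auto
  qed (rule der)
qed

lemma Cr_on_subset: "Cr_on r W f \<Longrightarrow> V \<subseteq> W \<Longrightarrow> Cr_on r V f"
  by (induction r arbitrary: f) (auto intro: continuous_on_subset)

lemma Cr_on_Suc_imp: "Cr_on (Suc r) W f \<Longrightarrow> Cr_on r W f"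
  by (induction r arbitrary: f) auto

lemma Cr_on_const: "Cr_on r W (\<lambda>z. c)"
proof (induction r arbitrary: c)
  case (Suc r)
  have "partial n b (\<lambda>z. c) = (\<lambda>z. 0)" for n and b :: 'a
    by (simp add: partial_def fun_eq_iff)
  with Suc show ?case by auto
qed simp

lemma Cr_on_coordinate: "Cr_on r W (\<lambda>z. z m \<bullet> c)"
proof (cases r)
  case 0
  then show ?thesis
    by (auto intro!: continuous_intros continuous_on_subset[OF continuous_on_product_coordinates])
next
  case (Suc k)
  have der: "((\<lambda>t. (z(n := z n + t *\<^sub>R b)) m \<bullet> c) has_real_derivative
      (if n = m then b \<bullet> c else 0)) (at 0)" for z :: "nat \<Rightarrow> 'a" and n b
    by (cases "n = m") (auto intro!: derivative_eq_intros simp: inner_add_left)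
  have "partial n b (\<lambda>z. z m \<bullet> c) = (\<lambda>z. if n = m then b \<bullet> c else 0)" for n b
    using partial_eqI[OF der] by (simp add: fun_eq_iff)
  then show ?thesis
    unfolding Suc
    by (intro Cr_on_SucI[OF _ der])
      (auto intro!: continuous_intros continuous_on_subset[OF continuous_on_product_coordinates]
        Cr_on_const)
qed

lemma Cr_on_add:
  assumes "open W" "Cr_on r W f" "Cr_on r W g"
  shows "Cr_on r W (\<lambda>z. f z + g z)"
  using assms(2,3)
proof (induction r arbitrary: f g)
  case 0
  then show ?case using continuous_on_add[of W f g] by simp
next
  case (Suc r)
  have der: "((\<lambda>t. f (z(n := z n + t *\<^sub>R b)) + g (z(n := z n + t *\<^sub>R b)))
      has_real_derivative partial n b f z + partial n b g z) (at 0)"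
    if "b \<in> Basis" "z \<in> W" for n b z
    by (rule DERIV_add[OF Cr_on_derivative[OF Suc.prems(1) that(2,1)]
          Cr_on_derivative[OF Suc.prems(2) that(2,1)]])
  have par: "partial n b f z + partial n b g z = partial n b (\<lambda>z. f z + g z) z"
    if "b \<in> Basis" "z \<in> W" for n b z
    by (rule sym, rule partial_eqI) (rule der[OF that])
  show ?case
  proof (rule Cr_on_SucI)
    show "continuous_on W (\<lambda>z. f z + g z)"
      using Suc.prems by (intro continuous_on_add Cr_on_continuous)
    show "Cr_on r W (partial n b (\<lambda>z. f z + g z))" if "b \<in> Basis" for n b
      by (rule Cr_on_cong[OF \<open>open W\<close> par[OF that]])
        (use Suc.prems that in \<open>auto intro: Suc.IH\<close>)
  qed (rule der)
qed

lemma Cr_on_mult: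
  assumes "open W" "Cr_on r W f" "Cr_on r W g"
  shows "Cr_on r W (\<lambda>z. f z * g z)"
  using assms(2,3)
proof (induction r arbitrary: f g)
  case 0
  then show ?case using continuous_on_mult[of W f g] by simp
next
  case (Suc r)
  have der: "((\<lambda>t. f (z(n := z n + t *\<^sub>R b)) * g (z(n := z n + t *\<^sub>R b)))
      has_real_derivative partial n b f z * g z + partial n b g z * f z) (at 0)"
    if "b \<in> Basis" "z \<in> W" for n b z
    using DERIV_mult[OF Cr_on_derivative[OF Suc.prems(1) that(2,1), of n]
        Cr_on_derivative[OF Suc.prems(2) that(2,1), of n]]
    by (simp only: scaleR_zero_left add_0_right fun_upd_triv)
  have par: "partial n b f z * g z + partial n b g z * f z = partial n b (\<lambda>z. f z * g z) z"
    if "b \<in> Basis" "z \<in> W" for n b z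
    by (rule sym, rule partial_eqI) (rule der[OF that])
  show ?case
  proof (rule Cr_on_SucI)
    show "continuous_on W (\<lambda>z. f z * g z)"
      using Suc.prems by (intro continuous_on_mult Cr_on_continuous)
    show "Cr_on r W (partial n b (\<lambda>z. f z * g z))" if "b \<in> Basis" for n b
      using Suc.prems Suc.prems[THEN Cr_on_Suc_imp] that
      by (intro Cr_on_cong[OF \<open>open W\<close> par[OF that]] Cr_on_add[OF \<open>open W\<close>] Suc.IH) auto
  qed (rule der)
qed

lemma Cr_on_sum:
  assumes "open W" "\<And>i. i \<in> I \<Longrightarrow> Cr_on r W (f i)"
  shows "Cr_on r W (\<lambda>z. \<Sum>i\<in>I. f i z)"
  using assms(2)
proof (induction I rule: infinite_finite_induct)
  case (insert i I)
  then show ?case by (auto intro: Cr_on_add[OF \<open>open W\<close>])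
qed (auto intro: Cr_on_const)

text \<open>One step of the telescoping sum behind the chain rule: moving one further coordinate along
\<open>s\<close> adds one term to the derivative.  By the mean value theorem the increment is \<open>s t\<close> times a value
of the partial derivative at a nearby point, and the partial derivative is continuous.\<close>

lemma derivative_move_coordinate:
  fixes h :: "(nat \<Rightarrow> 'a::euclidean_space) \<Rightarrow> real"
  assumes C1: "Cr_on (Suc r) W h" and W: "open W" "z \<in> W" and b: "b \<in> Basis"
    and p: "(p \<longlongrightarrow> z) (nhds 0)"
    and hp: "((\<lambda>t. h (p t)) has_real_derivative D) (at 0)"
    and s: "(s has_real_derivative s') (at 0)" "s 0 = 0"
  shows "((\<lambda>t. h ((p t)(n := p t n + s t *\<^sub>R b)))
           has_real_derivative D + partial n b h z * s') (at 0)"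
proof -
  define q where "q t \<theta> = (p t)(n := p t n + \<theta> *\<^sub>R b)" for t \<theta>
  define g where "g = partial n b h"
  have g: "continuous_on W g"
    unfolding g_def by (rule Cr_on_continuous[of r]) (use C1 b in auto)
  have "((\<lambda>x. q (fst x) (snd x)) \<longlongrightarrow> z) (nhds 0 \<times>\<^sub>F nhds 0)"
  proof (rule tendsto_coordinatewise)
    fix i
    have pi: "((\<lambda>t. p t i) \<longlongrightarrow> z i) (nhds 0)"
    proof (rule topological_tendstoI)
      fix A assume "open A" "z i \<in> A"
      moreover have "open ((\<lambda>w. w i) -` A)"
        using continuous_on_product_coordinates \<open>open A\<close> by (rule open_vimage[rotated])
      ultimately show "\<forall>\<^sub>F t in nhds 0. p t i \<in> A"
        using topological_tendstoD[OF p, of "(\<lambda>w. w i) -` A"] by auto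
    qed
    have p1: "((\<lambda>x. p (fst x) i) \<longlongrightarrow> z i) (nhds 0 \<times>\<^sub>F nhds (0::real))"
      by (rule filterlim_compose[OF pi filterlim_fst])
    have p2: "((\<lambda>x. snd x) \<longlongrightarrow> 0) (nhds (0::real) \<times>\<^sub>F nhds (0::real))"
      by (rule filterlim_snd)
    have "((\<lambda>x. p (fst x) i + snd x *\<^sub>R b) \<longlongrightarrow> z i + 0 *\<^sub>R b) (nhds 0 \<times>\<^sub>F nhds (0::real))"
      by (intro tendsto_intros p1 p2)
    with p1 show "((\<lambda>x. q (fst x) (snd x) i) \<longlongrightarrow> z i) (nhds 0 \<times>\<^sub>F nhds 0)"
      by (cases "i = n") (auto simp: q_def)
  qed
  note q = this
  \<comment> \<open>The error of the linear approximation in the moved coordinate; it is \<open>o(t)\<close>.\<close>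
  define R where "R t = h (q t (s t)) - h (p t) - g z * s t" for t
  have small: "\<forall>\<^sub>F t in at 0. \<bar>R t\<bar> \<le> e * \<bar>s t\<bar>" if "e > 0" for e
  proof -
    have "\<forall>\<^sub>F w in at z within W. dist (g w) (g z) < e"
      using g W(2) \<open>e > 0\<close> by (auto simp: continuous_on_def tendsto_iff)
    then have "\<forall>\<^sub>F w in nhds z. w \<in> W \<longrightarrow> dist (g w) (g z) < e"
      using \<open>e > 0\<close> by (auto simp: eventually_at_filter elim!: eventually_mono)
    with eventually_nhds_in_open[OF W] have "\<forall>\<^sub>F w in nhds z. w \<in> W \<and> dist (g w) (g z) < e"
      by eventually_elim auto
    from eventually_compose_filterlim[OF this q]
    obtain P Q where PQ: "eventually P (nhds (0::real))" "eventually Q (nhds (0::real))"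
        "\<And>t \<theta>. P t \<Longrightarrow> Q \<theta> \<Longrightarrow> q t \<theta> \<in> W \<and> dist (g (q t \<theta>)) (g z) < e"
      unfolding eventually_prod_filter by auto
    obtain d where d: "d > 0" "\<And>\<theta>. \<bar>\<theta>\<bar> < d \<Longrightarrow> Q \<theta>"
      using PQ(2) by (auto simp: eventually_nhds_metric)
    have "(s \<longlongrightarrow> 0) (at 0)"
      using DERIV_isCont[OF s(1)] s(2) by (simp add: isCont_def)
    then have "\<forall>\<^sub>F t in at 0. \<bar>s t\<bar> < d"
      using d(1) by (auto simp: tendsto_iff)
    moreover have "eventually P (at 0)"
      using PQ(1) eventually_nhds_conv_at by blast
    ultimately show ?thesis
    proof eventually_elim
      case (elim t)
      have "norm ((h (q t (s t)) - g z * s t) - (h (q t 0) - g z * 0)) \<le> e * norm (s t - 0)"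
      proof (rule field_differentiable_bound[where S = "ball 0 d" and f' = "\<lambda>\<theta>. g (q t \<theta>) - g z"])
        fix \<theta> :: real assume "\<theta> \<in> ball 0 d"
        then have \<theta>: "q t \<theta> \<in> W" "dist (g (q t \<theta>)) (g z) < e"
          using PQ(3) d(2) elim by auto
        have "((\<lambda>\<tau>. h (q t (\<theta> + \<tau>))) has_real_derivative g (q t \<theta>)) (at 0)"
          using Cr_on_derivative[OF C1 \<theta>(1) b, of n]
          by (simp add: q_def g_def scaleR_add_left add.assoc)
        then have "((\<lambda>\<tau>. h (q t \<tau>)) has_real_derivative g (q t \<theta>)) (at \<theta>)"
          using DERIV_shift[of "\<lambda>\<tau>. h (q t \<tau>)" "g (q t \<theta>)" 0 \<theta>] by (simp add: add.commute)
        then show "((\<lambda>\<theta>. h (q t \<theta>) - g z * \<theta>) has_field_derivative g (q t \<theta>) - g z)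
            (at \<theta> within ball 0 d)"
          by (intro DERIV_subset[OF DERIV_diff[OF _ DERIV_cmult_Id]]) auto
        show "norm (g (q t \<theta>) - g z) \<le> e"
          using \<theta>(2) by (simp add: dist_norm)
      qed (use elim d in auto)
      moreover have "q t 0 = p t" by (simp add: q_def)
      ultimately show ?case by (simp add: R_def algebra_simps)
    qed
  qed
  have R: "(R has_real_derivative 0) (at 0)"
  proof -
    have R0: "R 0 = 0" by (simp add: R_def q_def s(2))
    have "((\<lambda>t. R t / t) \<longlongrightarrow> 0) (at 0)"
    proof (rule tendstoI)
      fix \<epsilon> :: real assume "\<epsilon> > 0"
      define c where "c = \<bar>s'\<bar> + 1"
      define e where "e = \<epsilon> / 2 / c"
      have "c > 0" by (simp add: c_def)
      then have e: "e > 0" "e * c < \<epsilon>"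
        using \<open>\<epsilon> > 0\<close> by (simp_all add: e_def)
      have "((\<lambda>t. \<bar>s t / t\<bar>) \<longlongrightarrow> \<bar>s'\<bar>) (at 0)"
        using s by (intro tendsto_rabs) (simp add: has_field_derivative_iff)
      then have "\<forall>\<^sub>F t in at 0. \<bar>s t / t\<bar> < c"
        by (rule order_tendstoD) (simp add: c_def)
      with small[OF e(1)] show "\<forall>\<^sub>F t in at 0. dist (R t / t) 0 < \<epsilon>"
      proof eventually_elim
        case (elim t)
        have "\<bar>R t / t\<bar> \<le> e * \<bar>s t / t\<bar>"
          using divide_right_mono[OF elim(1), of "\<bar>t\<bar>"] by simp
        also have "\<dots> \<le> e * c"
          using elim(2) e(1) by (intro mult_left_mono) auto
        finally show ?case using e(2) by simp
      qed
    qed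
    then show ?thesis using R0 by (simp add: has_field_derivative_iff)
  qed
  have "((\<lambda>t. h (p t) + (g z * s t + R t)) has_real_derivative D + (g z * s' + 0)) (at 0)"
    by (intro DERIV_add hp R DERIV_cmult s)
  then show ?thesis by (simp add: R_def q_def g_def)
qed

text \<open>Only the coordinates up to the order \<open>N\<close> count, so the curve may be replaced by one that moves
finitely many coordinates, and these are moved one after another.\<close>

lemma derivative_along_curve:
  fixes h :: "(nat \<Rightarrow> 'a::euclidean_space) \<Rightarrow> real"
  assumes C1: "Cr_on (Suc r) W h" and W: "open W" "\<gamma> 0 \<in> W"
    and order: "\<And>z w. z \<in> W \<Longrightarrow> w \<in> W \<Longrightarrow> (\<And>n. n \<le> N \<Longrightarrow> z n = w n) \<Longrightarrow> h z = h w"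
    and \<gamma>: "\<And>m b. b \<in> Basis \<Longrightarrow> ((\<lambda>t. \<gamma> t m \<bullet> b) has_real_derivative \<gamma>' m b) (at 0)"
  shows "((\<lambda>t. h (\<gamma> t)) has_real_derivative
           (\<Sum>(m, b)\<in>{..N} \<times> Basis. partial m b h (\<gamma> 0) * \<gamma>' m b)) (at 0)"
proof -
  define s where "s m b t = (\<gamma> t m - \<gamma> 0 m) \<bullet> b" for m t and b :: 'a
  \<comment> \<open>Only the coordinates in \<open>P\<close> follow the curve, all others stay at their value at \<open>0\<close>.\<close>
  define p where "p P t = (\<lambda>m. \<gamma> 0 m + (\<Sum>b | b \<in> Basis \<and> (m, b) \<in> P. s m b t *\<^sub>R b))" for P t
  have s: "(s m b has_real_derivative \<gamma>' m b) (at 0)" "s m b 0 = 0" if "b \<in> Basis" for m b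
  proof -
    have "s m b = (\<lambda>t. \<gamma> t m \<bullet> b - \<gamma> 0 m \<bullet> b)"
      by (simp add: s_def inner_diff_left fun_eq_iff)
    then show "(s m b has_real_derivative \<gamma>' m b) (at 0)"
      using DERIV_diff[OF \<gamma>[OF that] DERIV_const] by simp
  qed (simp add: s_def)
  have s_lim: "(s m b \<longlongrightarrow> 0) (nhds 0)" if "b \<in> Basis" for m b
    using DERIV_isCont[OF s(1)[OF that]] s(2)[OF that] by (metis tendsto_at_iff_tendsto_nhds isCont_def)
  have p_lim: "(p P \<longlongrightarrow> \<gamma> 0) (nhds 0)" for P
  proof (rule tendsto_coordinatewise)
    fix m
    have "((\<lambda>t. \<gamma> 0 m + (\<Sum>b | b \<in> Basis \<and> (m, b) \<in> P. s m b t *\<^sub>R b)) \<longlongrightarrow>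
       \<gamma> 0 m + (\<Sum>b | b \<in> Basis \<and> (m, b) \<in> P. 0 *\<^sub>R b)) (nhds 0)"
      by (intro tendsto_intros s_lim) auto
    then show "((\<lambda>t. p P t m) \<longlongrightarrow> \<gamma> 0 m) (nhds 0)"
      by (simp add: p_def)
  qed
  have part: "((\<lambda>t. h (p P t)) has_real_derivative (\<Sum>(m, b)\<in>P. partial m b h (\<gamma> 0) * \<gamma>' m b)) (at 0)"
    if "finite P" "P \<subseteq> UNIV \<times> Basis" for P
    using that
  proof (induction P rule: finite_induct)
    case empty
    then show ?case by (simp add: p_def)
  next
    case (insert mb P)
    obtain m b where mb: "mb = (m, b)" "b \<in> Basis" "(m, b) \<notin> P" using insert by auto
    have "p (insert mb P) t = (p P t)(m := p P t m + s m b t *\<^sub>R b)" for t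
    proof
      fix k
      have "{b'. b' \<in> Basis \<and> (m, b') \<in> insert mb P} = insert b {b'. b' \<in> Basis \<and> (m, b') \<in> P}"
        using mb by auto
      then show "p (insert mb P) t k = ((p P t)(m := p P t m + s m b t *\<^sub>R b)) k"
        using mb by (cases "k = m") (auto simp: p_def)
    qed
    moreover have "((\<lambda>t. h ((p P t)(m := p P t m + s m b t *\<^sub>R b))) has_real_derivative
        (\<Sum>(m, b)\<in>P. partial m b h (\<gamma> 0) * \<gamma>' m b) + partial m b h (\<gamma> 0) * \<gamma>' m b) (at 0)"
      using insert mb by (intro derivative_move_coordinate[OF C1 W mb(2) p_lim] s) auto
    moreover have "(\<Sum>(m, b)\<in>insert mb P. partial m b h (\<gamma> 0) * \<gamma>' m b) =
        (\<Sum>(m, b)\<in>P. partial m b h (\<gamma> 0) * \<gamma>' m b) + partial m b h (\<gamma> 0) * \<gamma>' m b"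
      using insert(1) mb by (simp add: add.commute)
    ultimately show ?case
      by (simp only:)
  qed
  let ?P = "{..N} \<times> (Basis :: 'a set)"
  have full: "p ?P t m = \<gamma> t m" if "m \<le> N" for t m
  proof -
    have "p ?P t m = \<gamma> 0 m + (\<Sum>b\<in>Basis. s m b t *\<^sub>R b)"
      using that by (simp add: p_def)
    also have "(\<Sum>b\<in>Basis. s m b t *\<^sub>R b) = \<gamma> t m - \<gamma> 0 m"
      unfolding s_def by (rule euclidean_representation)
    finally show ?thesis by simp
  qed
  have \<gamma>_lim: "(\<gamma> \<longlongrightarrow> \<gamma> 0) (nhds 0)"
  proof (rule tendsto_coordinatewise)
    fix m
    have "((\<lambda>t. \<gamma> 0 m + (\<Sum>b\<in>Basis. s m b t *\<^sub>R b)) \<longlongrightarrow> \<gamma> 0 m + (\<Sum>b\<in>(Basis::'a set). 0 *\<^sub>R b)) (nhds 0)"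
      by (intro tendsto_intros s_lim) auto
    then show "((\<lambda>t. \<gamma> t m) \<longlongrightarrow> \<gamma> 0 m) (nhds 0)"
      by (simp add: s_def euclidean_representation)
  qed
  have "\<forall>\<^sub>F t in nhds 0. p ?P t \<in> W" "\<forall>\<^sub>F t in nhds 0. \<gamma> t \<in> W"
    using topological_tendstoD W p_lim \<gamma>_lim by metis+
  then have "\<forall>\<^sub>F t in nhds 0. h (p ?P t) = h (\<gamma> t)"
    by eventually_elim (rule order, auto simp: full)
  from DERIV_cong_ev[OF refl this refl] part[of ?P] show ?thesis by auto
qed

lemma partial_finite_order:
  assumes W: "open W" "z \<in> W" "w \<in> W"
    and order: "\<And>z w. z \<in> W \<Longrightarrow> w \<in> W \<Longrightarrow> (\<And>n. n \<le> N \<Longrightarrow> z n = w n) \<Longrightarrow> h z = h w"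
    and eq: "\<And>n. n \<le> N \<Longrightarrow> z n = w n"
    and diff: "((\<lambda>t. h (z(n := z n + t *\<^sub>R b))) has_real_derivative D) (at 0)"
  shows "partial n b h z = partial n b h w"
proof -
  have "\<forall>\<^sub>F t in nhds 0. h (z(n := z n + t *\<^sub>R b)) = h (w(n := w n + t *\<^sub>R b))"
    using eventually_upd_add[OF W(1,2), of n b] eventually_upd_add[OF W(1,3), of n b]
    by eventually_elim (rule order, auto simp: eq)
  from DERIV_cong_ev[OF refl this refl, THEN iffD1, OF diff]
  have "partial n b h w = D" by (rule partial_eqI)
  moreover have "partial n b h z = D" using diff by (rule partial_eqI)
  ultimately show ?thesis by simp
qed

text \<open>By the chain rule the partial derivatives of the composition are sums of products of functions
to which the induction hypothesis applies; the partial derivatives of \<open>h\<close> inherit the order \<open>N\<close>, so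
the sums stay finite.\<close>

theorem Cr_on_compose:
  fixes h :: "(nat \<Rightarrow> 'a::euclidean_space) \<Rightarrow> real"
    and \<phi> :: "(nat \<Rightarrow> 'b::euclidean_space) \<Rightarrow> (nat \<Rightarrow> 'a)"
  assumes "open V" "open W" "\<phi> ` V \<subseteq> W"
    and \<phi>: "\<And>m c. c \<in> Basis \<Longrightarrow> Cr_on r V (\<lambda>\<kappa>. \<phi> \<kappa> m \<bullet> c)"
    and h: "Cr_on r W h"
    and order: "\<And>z w. z \<in> W \<Longrightarrow> w \<in> W \<Longrightarrow> (\<And>n. n \<le> N \<Longrightarrow> z n = w n) \<Longrightarrow> h z = h w"
  shows "Cr_on r V (\<lambda>\<kappa>. h (\<phi> \<kappa>))"
  using \<phi> h order
proof (induction r arbitrary: h)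
  case (0 h)
  have "continuous_on V \<phi>"
  proof (rule continuous_on_coordinatewise_then_product)
    fix m
    have "continuous_on V (\<lambda>\<kappa>. \<Sum>c\<in>Basis. (\<phi> \<kappa> m \<bullet> c) *\<^sub>R c)"
      using 0(1) by (intro continuous_on_sum continuous_on_scaleR continuous_on_const) simp
    then show "continuous_on V (\<lambda>\<kappa>. \<phi> \<kappa> m)" by (simp add: euclidean_representation)
  qed
  with 0(2) show ?case
    using continuous_on_compose2[of W h V \<phi>] assms(3) by simp
next
  case (Suc r h)
  define g where "g \<kappa> n b = (\<Sum>(m, c)\<in>{..N} \<times> Basis.
      partial m c h (\<phi> \<kappa>) * partial n b (\<lambda>\<kappa>. \<phi> \<kappa> m \<bullet> c) \<kappa>)" for \<kappa> n b
  have der: "((\<lambda>t. h (\<phi> (\<kappa>(n := \<kappa> n + t *\<^sub>R b)))) has_real_derivative g \<kappa> n b) (at 0)"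
    if "b \<in> Basis" "\<kappa> \<in> V" for \<kappa> n b
  proof -
    have 0: "\<kappa>(n := \<kappa> n + 0 *\<^sub>R b) = \<kappa>" by simp
    have "\<phi> (\<kappa>(n := \<kappa> n + 0 *\<^sub>R b)) \<in> W"
      unfolding 0 using that assms(3) by blast
    from derivative_along_curve[OF Suc.prems(2) \<open>open W\<close> this Suc.prems(3)
        Cr_on_derivative[OF Suc.prems(1) that(2,1)], unfolded 0]
    show ?thesis unfolding g_def .
  qed
  have par: "g \<kappa> n b = partial n b (\<lambda>\<kappa>. h (\<phi> \<kappa>)) \<kappa>" if "b \<in> Basis" "\<kappa> \<in> V" for \<kappa> n b
    by (rule sym, rule partial_eqI) (rule der[OF that])
  show ?case
  proof (rule Cr_on_SucI)
    have comps: "Cr_on r V (\<lambda>\<kappa>. \<phi> \<kappa> m \<bullet> c)" if "c \<in> Basis" for m c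
      using Suc.prems(1)[OF that] by (rule Cr_on_Suc_imp)
    show "continuous_on V (\<lambda>\<kappa>. h (\<phi> \<kappa>))"
      by (rule Cr_on_continuous, rule Suc.IH[OF comps Cr_on_Suc_imp[OF Suc.prems(2)] Suc.prems(3)])
    fix n and b :: 'b assume b: "b \<in> Basis"
    have "Cr_on r V (\<lambda>\<kappa>. partial m c h (\<phi> \<kappa>))" if "c \<in> Basis" for m c
    proof (rule Suc.IH[OF comps])
      show "Cr_on r W (partial m c h)" using Suc.prems(2) that by simp
      show "partial m c h z = partial m c h w"
        if "z \<in> W" "w \<in> W" "\<And>n. n \<le> N \<Longrightarrow> z n = w n" for z w
        by (rule partial_finite_order[OF \<open>open W\<close> that(1,2) Suc.prems(3) that(3)
              Cr_on_derivative[OF Suc.prems(2) that(1) \<open>c \<in> Basis\<close>]])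
    qed
    moreover have "Cr_on r V (partial n b (\<lambda>\<kappa>. \<phi> \<kappa> m \<bullet> c))" if "c \<in> Basis" for m c
      using Suc.prems(1)[OF that] b by simp
    ultimately have g: "Cr_on r V (\<lambda>\<kappa>. g \<kappa> n b)"
      unfolding g_def case_prod_beta
      by (intro Cr_on_sum Cr_on_mult \<open>open V\<close>) auto
    show "Cr_on r V (partial n b (\<lambda>\<kappa>. h (\<phi> \<kappa>)))"
      by (rule Cr_on_cong[OF \<open>open V\<close> _ g]) (rule par[OF b])
  qed (rule der)
qed

section \<open>Smooth curves\<close>

lemma nderiv_0 [simp]: "nderiv 0 f = f"
  by (simp add: nderiv_def)

lemma nderiv_Suc: "nderiv (Suc n) f x = vector_derivative (nderiv n f) (at x)"
  by (simp add: nderiv_def)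

lemma smooth_curve_on_derivative:
  assumes "smooth_curve_on S f" "x \<in> S"
  shows "(nderiv n f has_vector_derivative nderiv (Suc n) f x) (at x)"
  using assms by (auto simp: smooth_curve_on_def nderiv_Suc vector_derivative_works[symmetric])

text \<open>The higher derivatives are iterated total functions, so they are identified from any sequence
of successive derivatives on an open set; outside that set nothing is known about them.\<close>

lemma nderiv_unique:
  assumes "open S" and F: "\<And>n x. x \<in> S \<Longrightarrow> (F n has_vector_derivative F (Suc n) x) (at x)"
    and "\<And>x. x \<in> S \<Longrightarrow> f x = F 0 x"
  shows "x \<in> S \<Longrightarrow> nderiv n f x = F n x"
proof (induction n arbitrary: x)
  case (Suc n)
  have "(nderiv n f has_vector_derivative F (Suc n) x) (at x)"
    by (rule has_vector_derivative_transform_within_open[OF F \<open>open S\<close>])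
      (use Suc in auto)
  then show ?case by (simp add: nderiv_Suc vector_derivative_at)
qed (use assms in auto)

lemma smooth_curve_onI:
  assumes "open S" and F: "\<And>n x. x \<in> S \<Longrightarrow> (F n has_vector_derivative F (Suc n) x) (at x)"
    and "\<And>x. x \<in> S \<Longrightarrow> f x = F 0 x"
  shows "smooth_curve_on S f"
  unfolding smooth_curve_on_def
proof (intro allI ballI)
  fix n x assume "x \<in> S"
  have "(nderiv n f has_vector_derivative F (Suc n) x) (at x)"
    by (rule has_vector_derivative_transform_within_open[OF F \<open>open S\<close>])
      (use nderiv_unique[OF assms] \<open>x \<in> S\<close> in auto)
  then show "nderiv n f differentiable at x"
    by (rule differentiableI_vector)
qed

text \<open>Every function in this class has a derivative on \<open>S\<close> that is again in the class, so all of them are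
smooth: closure under one derivation replaces formulas for the higher derivatives of products and
compositions.\<close>

inductive smooth_expr :: "real set \<Rightarrow> (real \<Rightarrow> real) \<Rightarrow> bool" for S where
  smooth: "smooth_curve_on S f \<Longrightarrow> smooth_expr S f"
| const: "smooth_expr S (\<lambda>x. c)"
| add: "smooth_expr S f \<Longrightarrow> smooth_expr S g \<Longrightarrow> smooth_expr S (\<lambda>x. f x + g x)"
| mult: "smooth_expr S f \<Longrightarrow> smooth_expr S g \<Longrightarrow> smooth_expr S (\<lambda>x. f x * g x)"
| inverse: "smooth_expr S f \<Longrightarrow> \<forall>x\<in>S. f x \<noteq> 0 \<Longrightarrow> smooth_expr S (\<lambda>x. inverse (f x))"
| sqrt: "smooth_expr S f \<Longrightarrow> \<forall>x\<in>S. f x > 0 \<Longrightarrow> smooth_expr S (\<lambda>x. sqrt (f x))"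

lemma smooth_expr_uminus: "smooth_expr S f \<Longrightarrow> smooth_expr S (\<lambda>x. - f x)"
  using smooth_expr.mult[OF smooth_expr.const[of S "-1"]] by simp

lemma smooth_expr_diff:
  "smooth_expr S f \<Longrightarrow> smooth_expr S g \<Longrightarrow> smooth_expr S (\<lambda>x. f x - g x)"
  using smooth_expr.add[OF _ smooth_expr_uminus] by simp

lemma smooth_expr_divide:
  "smooth_expr S f \<Longrightarrow> smooth_expr S g \<Longrightarrow> \<forall>x\<in>S. g x \<noteq> 0 \<Longrightarrow> smooth_expr S (\<lambda>x. f x / g x)"
  unfolding divide_inverse by (intro smooth_expr.mult smooth_expr.inverse)

lemma smooth_expr_power: "smooth_expr S f \<Longrightarrow> smooth_expr S (\<lambda>x. f x ^ n)"
  by (induction n) (auto intro: smooth_expr.const smooth_expr.mult)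

lemma smooth_expr_derivative:
  assumes "open S" "smooth_expr S f"
  shows "\<exists>g. smooth_expr S g \<and> (\<forall>x\<in>S. (f has_real_derivative g x) (at x))"
  using assms(2)
proof induction
  case (smooth f)
  have "smooth_curve_on S (nderiv 1 f)"
    by (rule smooth_curve_onI[OF \<open>open S\<close>, of "\<lambda>n. nderiv (Suc n) f"])
      (use smooth_curve_on_derivative[OF smooth] in auto)
  then show ?case
    using smooth_curve_on_derivative[OF smooth, of _ 0]
    by (intro exI[of _ "nderiv 1 f"])
      (auto simp: has_real_derivative_iff_has_vector_derivative intro: smooth_expr.smooth)
next
  case (const c)
  then show ?case
    by (intro exI[of _ "\<lambda>x. 0"]) (auto intro: smooth_expr.const)
next
  case (add f g)
  then show ?case by (blast intro: smooth_expr.add DERIV_add)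
next
  case (mult f g)
  then obtain f' g' where "smooth_expr S f'" "smooth_expr S g'"
    "\<forall>x\<in>S. (f has_real_derivative f' x) (at x)" "\<forall>x\<in>S. (g has_real_derivative g' x) (at x)"
    by blast
  with mult.hyps show ?case
    by (intro exI[of _ "\<lambda>x. f' x * g x + g' x * f x"] conjI smooth_expr.add smooth_expr.mult)
      (auto intro: DERIV_mult)
next
  case (inverse f)
  then obtain f' where f': "smooth_expr S f'" "\<forall>x\<in>S. (f has_real_derivative f' x) (at x)"
    by blast
  have "smooth_expr S (\<lambda>x. (-1) * (inverse (f x) * f' x * inverse (f x)))"
    by (intro smooth_expr.intros(2-5) f' inverse)
  moreover have "\<forall>x\<in>S. ((\<lambda>x. inverse (f x)) has_real_derivative
      (-1) * (inverse (f x) * f' x * inverse (f x))) (at x)"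
    using DERIV_inverse'[of f _ _ UNIV] f'(2) inverse.hyps(2) by auto
  ultimately show ?case by blast
next
  case (sqrt f)
  then obtain f' where f': "smooth_expr S f'" "\<forall>x\<in>S. (f has_real_derivative f' x) (at x)"
    by blast
  have "smooth_expr S (\<lambda>x. f' x * (inverse (sqrt (f x)) * (1/2)))"
    by (intro smooth_expr.mult smooth_expr.inverse smooth_expr.sqrt f' sqrt smooth_expr.const)
      (use sqrt.hyps(2) in fastforce)
  moreover have "((\<lambda>x. sqrt (f x)) has_real_derivative
      f' x * (inverse (sqrt (f x)) * (1/2))) (at x)" if "x \<in> S" for x
  proof -
    have "f x > 0" using sqrt.hyps(2) that by blast
    from DERIV_chain2[OF DERIV_real_sqrt[OF this] f'(2)[rule_format, OF that]]
    show ?thesis by (rule DERIV_cong) simp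
  qed
  ultimately show ?case by blast
qed

lemma smooth_expr_imp_smooth_curve_on:
  assumes "open S" "smooth_expr S f"
  shows "smooth_curve_on S f"
proof -
  have "\<exists>F. F 0 = f \<and> (\<forall>n. smooth_expr S (F n)) \<and>
      (\<forall>n. \<forall>x\<in>S. (F n has_real_derivative F (Suc n) x) (at x))"
    using dependent_nat_choice[of "\<lambda>n g. smooth_expr S g \<and> (n = 0 \<longrightarrow> g = f)"
        "\<lambda>n g g'. \<forall>x\<in>S. (g has_real_derivative g' x) (at x)"]
      assms(2) smooth_expr_derivative[OF assms(1)] by auto
  then show ?thesis
    by (auto simp: has_real_derivative_iff_has_vector_derivative intro!: smooth_curve_onI[OF assms(1)])
qed

lemma smooth_curve_on_component:
  fixes u :: "real \<Rightarrow> real^'n"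
  assumes "open S" "smooth_curve_on S u"
  shows "smooth_curve_on S (\<lambda>x. nderiv m u x $ i)"
proof (rule smooth_curve_onI[OF assms(1), of "\<lambda>n x. nderiv (n + m) u x $ i"])
  show "((\<lambda>x. nderiv (n + m) u x $ i) has_vector_derivative nderiv (Suc n + m) u x $ i) (at x)"
    if "x \<in> S" for n x
    using smooth_curve_on_derivative[OF assms(2) that, of "n + m"]
    by (auto intro: bounded_linear.has_vector_derivative[OF bounded_linear_vec_nth])
qed simp

lemma has_vector_derivative_componentwise:
  fixes f :: "real \<Rightarrow> 'a::euclidean_space^'n"
  assumes "\<And>i. ((\<lambda>x. f x $ i) has_vector_derivative f' $ i) (at x)"
  shows "(f has_vector_derivative f') (at x)"
  unfolding has_vector_derivative_def
proof (subst has_derivative_componentwise_within, intro ballI)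
  fix b :: "'a^'n" assume "b \<in> Basis"
  then obtain i c where b: "b = axis i c" by (auto simp: Basis_vec_def)
  show "((\<lambda>x. f x \<bullet> b) has_derivative (\<lambda>t. (t *\<^sub>R f') \<bullet> b)) (at x)"
    using has_derivative_inner_left[OF assms[of i, unfolded has_vector_derivative_def], of c]
    unfolding b by (simp add: inner_axis)
qed

lemma smooth_curve_on_componentwise:
  fixes u :: "real \<Rightarrow> 'a::euclidean_space^'n"
  assumes "open S" "\<And>i. smooth_curve_on S (\<lambda>x. u x $ i)"
  shows "smooth_curve_on S u"
proof (rule smooth_curve_onI[OF assms(1), of "\<lambda>n x. \<chi> i. nderiv n (\<lambda>x. u x $ i) x"])
  show "((\<lambda>x. \<chi> i. nderiv n (\<lambda>x. u x $ i) x) has_vector_derivative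
      (\<chi> i. nderiv (Suc n) (\<lambda>x. u x $ i) x)) (at x)" if "x \<in> S" for n x
    using smooth_curve_on_derivative[OF assms(2) that, where n = n]
    by (intro has_vector_derivative_componentwise) simp
qed simp

declare nderiv_0 [simp del]

section \<open>Lorentzian linear algebra\<close>

lemma vector_4 [simp]:
  "(vector [a, b, c, d] :: 'a::zero^4) $ 1 = a"
  "(vector [a, b, c, d] :: 'a::zero^4) $ 2 = b"
  "(vector [a, b, c, d] :: 'a::zero^4) $ 3 = c"
  "(vector [a, b, c, d] :: 'a::zero^4) $ 4 = d"
  unfolding vector_def by simp_all

lemma vec_eq_4: "(x :: 'a^4) = y \<longleftrightarrow> x$1 = y$1 \<and> x$2 = y$2 \<and> x$3 = y$3 \<and> x$4 = y$4"
  by (simp add: vec_eq_iff forall_4)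

lemma axis_4 [simp]:
  "axis (1::4) (c::real) $ 1 = c" "axis (1::4) (c::real) $ 2 = 0"
  "axis (1::4) (c::real) $ 3 = 0" "axis (1::4) (c::real) $ 4 = 0"
  "axis (2::4) (c::real) $ 1 = 0" "axis (2::4) (c::real) $ 2 = c"
  "axis (2::4) (c::real) $ 3 = 0" "axis (2::4) (c::real) $ 4 = 0"
  "axis (3::4) (c::real) $ 1 = 0" "axis (3::4) (c::real) $ 2 = 0"
  "axis (3::4) (c::real) $ 3 = c" "axis (3::4) (c::real) $ 4 = 0"
  "axis (4::4) (c::real) $ 1 = 0" "axis (4::4) (c::real) $ 2 = 0"
  "axis (4::4) (c::real) $ 3 = 0" "axis (4::4) (c::real) $ 4 = c"
  by (simp_all add: axis_def)

lemma matrix_vector_mult_4: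
  fixes A :: "real^4^4"
  shows "(A *v x) $ i = A$i$1 * x$1 + A$i$2 * x$2 + A$i$3 * x$3 + A$i$4 * x$4"
  by (simp add: matrix_vector_mult_def sum_4)

lemma ipJ_expand: "ipJ u v = u$2 * v$2 + u$3 * v$3 - u$1 * v$4 - u$4 * v$1"
  by (simp add: ipJ_def J_def inner_vec_def sum_4 matrix_vector_mult_4)

lemma ipJ_commute: "ipJ u v = ipJ v u"
  by (simp add: ipJ_expand)

lemma bounded_bilinear_ipJ: "bounded_bilinear ipJ"
  unfolding bilinear_conv_bounded_bilinear[symmetric] bilinear_def
  by (auto intro!: linearI simp: ipJ_expand algebra_simps)

interpretation ipJ: bounded_bilinear ipJ
  by (rule bounded_bilinear_ipJ)

lemma bounded_bilinear_matrix_vector_mult: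
  "bounded_bilinear ((*v) :: real^'n^'m \<Rightarrow> real^'n \<Rightarrow> real^'m)"
  unfolding bilinear_conv_bounded_bilinear[symmetric] bilinear_def
  by (auto intro!: linearI simp: matrix_vector_right_distrib matrix_vector_mult_add_rdistrib
      matrix_vector_mult_scaleR scaleR_matrix_vector_assoc[symmetric])

lemma ipJ_matrix: "ipJ (g *v u) (g *v v) = u \<bullet> ((transpose g ** J ** g) *v v)"
  by (simp add: ipJ_def matrix_vector_mul_assoc[symmetric] dot_lmul_matrix[symmetric]
      flip: transpose_matrix_vector)

lemma O31_ipJ: "g \<in> O31 \<Longrightarrow> ipJ (g *v u) (g *v v) = ipJ u v"
  unfolding ipJ_matrix by (simp add: O31_def ipJ_def)

lemma O31_normJ: "g \<in> O31 \<Longrightarrow> normJ (g *v u) = normJ u"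
  by (simp add: normJ_def O31_ipJ)

lemma det_4:
  "det (A::'a::comm_ring_1^4^4) =
     A$1$1 * (A$2$2 * (A$3$3 * A$4$4 - A$3$4 * A$4$3) - A$2$3 * (A$3$2 * A$4$4 - A$3$4 * A$4$2)
       + A$2$4 * (A$3$2 * A$4$3 - A$3$3 * A$4$2))
   - A$1$2 * (A$2$1 * (A$3$3 * A$4$4 - A$3$4 * A$4$3) - A$2$3 * (A$3$1 * A$4$4 - A$3$4 * A$4$1)
       + A$2$4 * (A$3$1 * A$4$3 - A$3$3 * A$4$1))
   + A$1$3 * (A$2$1 * (A$3$2 * A$4$4 - A$3$4 * A$4$2) - A$2$2 * (A$3$1 * A$4$4 - A$3$4 * A$4$1)
       + A$2$4 * (A$3$1 * A$4$2 - A$3$2 * A$4$1))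
   - A$1$4 * (A$2$1 * (A$3$2 * A$4$3 - A$3$3 * A$4$2) - A$2$2 * (A$3$1 * A$4$3 - A$3$3 * A$4$1)
       + A$2$3 * (A$3$1 * A$4$2 - A$3$2 * A$4$1))"
proof -
  have f1: "finite {2::4, 3, 4}" "1 \<notin> {2::4, 3, 4}" by auto
  have f2: "finite {3::4, 4}" "2 \<notin> {3::4, 4}" by auto
  have f3: "finite {4::4}" "3 \<notin> {4::4}" by auto
  show ?thesis
    unfolding det_def UNIV_4
    unfolding sum_over_permutations_insert[OF f1]
    unfolding sum_over_permutations_insert[OF f2]
    unfolding sum_over_permutations_insert[OF f3]
    unfolding permutes_sing
    by (simp add: sign_swap_id permutation_swap_id permutation_compose sign_compose sign_id
        swap_id_eq algebra_simps)
qed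

lemma det_J: "det J = -1"
  by (simp add: det_4 J_def)

lemma det_square_eq_1:
  assumes "transpose g ** J ** g = J"
  shows "(det g)\<^sup>2 = 1"
proof -
  have "det (transpose g ** J ** g) = det J" using assms by simp
  then show ?thesis by (simp add: det_mul det_J power2_eq_square)
qed

text \<open>Invertibility follows from preservation of the form: the determinant of a matrix that preserves the form squares to 1.\<close>

lemma O31_iff: "g \<in> O31 \<longleftrightarrow> (\<forall>u v. ipJ (g *v u) (g *v v) = ipJ u v)"
proof
  assume *: "\<forall>u v. ipJ (g *v u) (g *v v) = ipJ u v"
  have "transpose g ** J ** g = J"
    unfolding matrix_eq
  proof
    fix v
    have "u \<bullet> ((transpose g ** J ** g) *v v) = u \<bullet> (J *v v)" for u
      using * unfolding ipJ_matrix by (simp add: ipJ_def)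
    then show "(transpose g ** J ** g) *v v = J *v v" by (metis inner_commute vector_eq_ldot)
  qed
  moreover from det_square_eq_1[OF this] have "invertible g"
    by (auto simp: invertible_det_nz)
  ultimately show "g \<in> O31" by (simp add: O31_def)
qed (simp add: O31_ipJ)

lemma O31_det: "g \<in> O31 \<Longrightarrow> det g = 1 \<or> det g = -1"
  using det_square_eq_1[of g] by (simp add: O31_def power2_eq_1_iff)

lemma O31_mult: "g \<in> O31 \<Longrightarrow> h \<in> O31 \<Longrightarrow> g ** h \<in> O31"
  by (simp add: O31_iff flip: matrix_vector_mul_assoc)

lemma O31_inv:
  assumes "g \<in> O31"
  shows "matrix_inv g ** g = mat 1" "g ** matrix_inv g = mat 1" "matrix_inv g \<in> O31"
    "matrix_inv g *v (g *v x) = x" "g *v (matrix_inv g *v x) = x"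
proof -
  have "invertible g" using assms by (simp add: O31_def)
  then show l: "matrix_inv g ** g = mat 1" and r: "g ** matrix_inv g = mat 1"
    unfolding invertible_def matrix_inv_def by (metis (mono_tags, lifting) someI_ex)+
  show "matrix_inv g *v (g *v x) = x" "g *v (matrix_inv g *v x) = x" for x
    by (simp_all add: matrix_vector_mul_assoc l r)
  then show "matrix_inv g \<in> O31"
    unfolding O31_iff using O31_ipJ[OF assms] by metis
qed

definition det4 :: "real^4 \<Rightarrow> real^4 \<Rightarrow> real^4 \<Rightarrow> real^4 \<Rightarrow> real" where
  "det4 a b c d = det (vector [a, b, c, d] :: real^4^4)"

lemmas det4_expand = det4_def det_4 vector_4

lemma det4_matrix: "det4 (g *v a) (g *v b) (g *v c) (g *v d) = det g * det4 a b c d"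
proof -
  have "(vector [g *v a, g *v b, g *v c, g *v d] :: real^4^4) = vector [a, b, c, d] ** transpose g"
    by (simp add: vec_eq_4 matrix_matrix_mult_def transpose_def matrix_vector_mult_4 sum_4 mult.commute)
  then show ?thesis by (simp add: det4_def det_mul)
qed

lemma det4_axis1: "det4 (axis 1 1) a b c = det3 a b c"
  by (simp add: det4_expand det3_def det_3 algebra_simps)

lemma det4_diff_scaleR:
  "det4 (r *\<^sub>R p - s *\<^sub>R q) a b c = r * det4 p a b c - s * det4 q a b c"
  "det4 p a b (r *\<^sub>R c - s *\<^sub>R d) = r * det4 p a b c - s * det4 p a b d"
  by (simp_all add: det4_expand algebra_simps)

lemma det4_rotate: "det4 c a b d = det4 a b c d"
  by (simp add: det4_expand algebra_simps)

lemma det4_same: "det4 a b c c = 0"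
  by (simp add: det4_expand algebra_simps)

text \<open>All four rows lie in the hyperplane orthogonal to \<open>z\<close>, so \<open>J z\<close> is in the kernel of the matrix.\<close>

lemma det4_eq_0:
  assumes "z \<noteq> 0" "ipJ a z = 0" "ipJ b z = 0" "ipJ c z = 0" "ipJ d z = 0"
  shows "det4 a b c d = 0"
proof -
  have "J *v z \<noteq> 0"
    using det_J assms(1) by (metis invertible_det_nz invertible_def matrix_left_invertible_ker
        zero_neq_neg_one)
  moreover have "(vector [a, b, c, d] :: real^4^4) *v (J *v z) = 0"
    using assms(2-) by (simp add: vec_eq_4 matrix_vector_mult_4 ipJ_expand J_def)
  ultimately show ?thesis
    unfolding det4_def by (metis invertible_det_nz invertible_def matrix_left_invertible_ker)
qed

text \<open>The vector \<open>\<langle>q, z\<rangle> p - \<langle>p, z\<rangle> q\<close> is orthogonal to \<open>z\<close>, like \<open>a\<close>, \<open>b\<close> and \<open>c\<close>.  Taking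
\<open>q = e\<^sub>1\<close> relates the 4 by 4 determinant to the one in which the first component is dropped.\<close>

lemma det4_independent:
  assumes "z \<noteq> 0" "ipJ a z = 0" "ipJ b z = 0" "ipJ c z = 0"
  shows "ipJ q z * det4 p a b c = ipJ p z * det4 q a b c"
proof -
  have "det4 (ipJ q z *\<^sub>R p - ipJ p z *\<^sub>R q) a b c = 0"
    using assms by (intro det4_eq_0) (simp_all add: ipJ.diff_left ipJ.scaleR_left)
  then show ?thesis by (simp add: det4_diff_scaleR)
qed

section \<open>The moving frame of a jet\<close>

text \<open>The algebraic conditions on the first four derivatives of a non-radial curve in the upper cone:
the derivatives of \<open>\<langle>u, u\<rangle> = 0\<close> up to order three, and the two open conditions.  All pointwise facts
about frames follow from these alone.\<close>

definition cone_jet :: "jet \<Rightarrow> bool" where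
  "cone_jet z \<longleftrightarrow> ipJ (z 0) (z 0) = 0 \<and> ipJ (z 0) (z 1) = 0 \<and>
     ipJ (z 0) (z 2) = - ipJ (z 1) (z 1) \<and> ipJ (z 0) (z 3) = - 3 * ipJ (z 1) (z 2) \<and>
     z 0 $ 4 > 0 \<and> ipJ (z 1) (z 1) > 0"

text \<open>The form is positive semidefinite on the tangent hyperplane of the cone; its radical is the line
of \<open>u\<close>, which the explicit squares ignore.\<close>

lemma ipJ_tangent_nonneg:
  assumes "ipJ u u = 0" "ipJ u v = 0" "u $ 4 \<noteq> 0"
  shows "ipJ v v = (v$2 - u$2 / u$4 * v$4)\<^sup>2 + (v$3 - u$3 / u$4 * v$4)\<^sup>2"
proof -
  have u1: "u$1 = ((u$2)\<^sup>2 + (u$3)\<^sup>2) / (2 * u$4)"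
    using assms(1,3) by (simp add: ipJ_expand field_simps power2_eq_square)
  have v1: "v$1 = (u$2 * v$2 + u$3 * v$3 - u$1 * v$4) / u$4"
    using assms(2,3) by (simp add: ipJ_expand field_simps)
  show ?thesis
    using assms(3) unfolding ipJ_expand v1 u1 by (simp add: field_simps power2_eq_square)
qed

lemma cone_jet_normJ:
  assumes "cone_jet z"
  shows "normJ (z 1) > 0" "(normJ (z 1))\<^sup>2 = ipJ (z 1) (z 1)"
  using assms by (simp_all add: cone_jet_def normJ_def)

text \<open>The vector that the frame sends to \<open>e\<^sub>1\<close>: null, orthogonal to \<open>z 1\<close>, and paired to \<open>-1\<close> with
\<open>z 0\<close>.\<close>

definition null_partner :: "jet \<Rightarrow> real^4" where
  "null_partner z = (1 / (normJ (z 1))\<^sup>2) *\<^sub>R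
     (z 2 - (ipJ (z 1) (z 2) / (normJ (z 1))\<^sup>2) *\<^sub>R z 1 - (k\<^sub>0 z * k\<^sub>1 z) *\<^sub>R z 0)"

text \<open>The rows of the frame as covectors: each component of \<open>g w\<close> is up to sign the product of \<open>g w\<close>
with a basis vector, hence of \<open>w\<close> with its preimage; the third row is a generalized cross product.
The formula is rational in the jet and its norm, which makes the frame continuous in the jet and
smooth along a curve.\<close>

definition frame_matrix :: "jet \<Rightarrow> real^4^4" where
  "frame_matrix z = (\<chi> i j. let w = axis j 1 in
     (vector [- ipJ (z 0) w, ipJ (z 1) w / normJ (z 1),
       det4 (z 0) (z 1) (z 2) w / normJ (z 1) ^ 3, - ipJ (null_partner z) w] :: real^4) $ i)"

lemma frame_matrix_apply:
  "frame_matrix z *v w = vector [- ipJ (z 0) w, ipJ (z 1) w / normJ (z 1),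
     det4 (z 0) (z 1) (z 2) w / normJ (z 1) ^ 3, - ipJ (null_partner z) w]"
proof -
  have "det4 a b c w = det4 a b c (axis 1 1) * w $ 1 + det4 a b c (axis 2 1) * w $ 2
     + det4 a b c (axis 3 1) * w $ 3 + det4 a b c (axis 4 1) * w $ 4" for a b c w
    by (simp add: det4_expand algebra_simps)
  note d = this[of "z 0" "z 1" "z 2" w]
  show ?thesis
    unfolding vec_eq_4 matrix_vector_mult_4 
    by (simp add: frame_matrix_def Let_def ipJ_expand d divide_inverse algebra_simps
        del: One_nat_def)
qed

lemma det_factors:
  "det (lower_factor \<xi>) = 1" "det (upper_factor v) = 1"
  "\<alpha> \<noteq> 0 \<Longrightarrow> det (diag_factor \<alpha> A) = det A"
  by (simp_all add: det_4 det_2 lower_factor_def upper_factor_def diag_factor_def field_simps)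

lemma frame_form_det: "frame_form g \<Longrightarrow> det g = 1"
  by (auto simp: frame_form_def det_mul det_factors rotation_matrix_def)

lemma factors_O31:
  "lower_factor \<xi> \<in> O31" "upper_factor v \<in> O31"
  "\<alpha> \<noteq> 0 \<Longrightarrow> rotation_matrix A \<Longrightarrow> diag_factor \<alpha> A \<in> O31"
proof -
  have n: "(norm x)\<^sup>2 = (x$1)\<^sup>2 + (x$2)\<^sup>2" for x :: "real^2"
    by (simp add: norm_vec_def L2_set_def sum_2)
  show "lower_factor \<xi> \<in> O31" "upper_factor v \<in> O31"
    unfolding O31_iff ipJ_expand matrix_vector_mult_4 lower_factor_def upper_factor_def n
    by (simp_all add: field_simps power2_eq_square)
  assume "\<alpha> \<noteq> 0" "rotation_matrix A"
  then have "transpose A ** A = mat 1"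
    by (simp add: rotation_matrix_def orthogonal_matrix_def)
  then have A: "A$1$1 * A$1$1 + A$2$1 * A$2$1 = 1" "A$1$2 * A$1$2 + A$2$2 * A$2$2 = 1"
      "A$1$1 * A$1$2 + A$2$1 * A$2$2 = 0"
    by (auto simp: vec_eq_iff matrix_matrix_mult_def transpose_def mat_def forall_2 sum_2)
  show "diag_factor \<alpha> A \<in> O31"
    unfolding O31_iff
  proof (intro allI)
    fix u v :: "real^4"
    have "ipJ (diag_factor \<alpha> A *v u) (diag_factor \<alpha> A *v v) =
      (A$1$1 * A$1$1 + A$2$1 * A$2$1) * (u$2 * v$2) + (A$1$2 * A$1$2 + A$2$2 * A$2$2) * (u$3 * v$3)
      + (A$1$1 * A$1$2 + A$2$1 * A$2$2) * (u$2 * v$3 + u$3 * v$2) - u$1 * v$4 - u$4 * v$1"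
      using \<open>\<alpha> \<noteq> 0\<close> unfolding ipJ_expand matrix_vector_mult_4 diag_factor_def
      by (simp add: field_simps)
    then show "ipJ (diag_factor \<alpha> A *v u) (diag_factor \<alpha> A *v v) = ipJ u v"
      by (simp add: A ipJ_expand)
  qed
qed

(* Jet indices stay literal numerals: z 1 must not turn into z (Suc 0). *)
declare One_nat_def [simp del]

text \<open>The first two components of \<open>g z\<^sub>2\<close> are products with \<open>g z\<^sub>0\<close> and \<open>g z\<^sub>1\<close>, the third is
normalized to zero, and the last is then forced by \<open>\<langle>g z\<^sub>2, g z\<^sub>2\<rangle> = \<langle>z\<^sub>2, z\<^sub>2\<rangle>\<close>.\<close>

lemma frame_on_jet:
  assumes z: "cone_jet z" and g: "is_frame z g"
  shows "g *v z 0 = axis 4 1" "g *v z 1 = normJ (z 1) *\<^sub>R axis 2 1"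
    "g *v z 2 = vector [(normJ (z 1))\<^sup>2, ipJ (z 1) (z 2) / normJ (z 1), 0, k\<^sub>0 z * k\<^sub>1 z]"
proof -
  let ?k = "normJ (z 1)"
  note k = cone_jet_normJ[OF z]
  have O: "g \<in> O31" using g by (simp add: is_frame_def)
  show z0: "g *v z 0 = axis 4 1" and z1: "g *v z 1 = ?k *\<^sub>R axis 2 1"
    using g by (simp_all add: is_frame_def)
  have "(g *v z 2) $ 1 = - ipJ (g *v z 0) (g *v z 2)"
    unfolding z0 by (simp add: ipJ_expand)
  then have 1: "(g *v z 2) $ 1 = ?k\<^sup>2"
    using z by (simp add: O31_ipJ[OF O] cone_jet_def k)
  have "?k * (g *v z 2) $ 2 = ipJ (g *v z 1) (g *v z 2)"
    unfolding z1 by (simp add: ipJ_expand)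
  then have 2: "(g *v z 2) $ 2 = ipJ (z 1) (z 2) / ?k"
    using k by (simp add: O31_ipJ[OF O] field_simps)
  have 3: "(g *v z 2) $ 3 = 0" using g by (simp add: is_frame_def)
  have "ipJ (z 2) (z 2) = ipJ (g *v z 2) (g *v z 2)"
    by (simp add: O31_ipJ[OF O])
  also have "\<dots> = (ipJ (z 1) (z 2) / ?k)\<^sup>2 - 2 * ?k\<^sup>2 * (g *v z 2) $ 4"
    unfolding ipJ_expand[of "g *v z 2"] 1 2 3 by (simp add: power2_eq_square)
  finally have "(2 * ?k\<^sup>2) * (g *v z 2) $ 4 = (ipJ (z 1) (z 2) / ?k)\<^sup>2 - ipJ (z 2) (z 2)"
    by simp
  then have "(g *v z 2) $ 4 = ((ipJ (z 1) (z 2) / ?k)\<^sup>2 - ipJ (z 2) (z 2)) / (2 * ?k\<^sup>2)"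
    using k(1) by (metis mult_eq_0_iff nonzero_mult_div_cancel_left order_less_irrefl
        power_eq_0_iff zero_neq_numeral)
  also have "\<dots> = k\<^sub>0 z * k\<^sub>1 z"
  proof -
    have 5: "?k ^ 5 = ?k * ?k\<^sup>2 * ?k\<^sup>2" by (simp add: power_numeral_reduce)
    show ?thesis
      using k(1) unfolding k\<^sub>0_def k\<^sub>1_def 5
      by (simp add: power_divide diff_divide_distrib right_diff_distrib)
  qed
  finally show "g *v z 2 = vector [?k\<^sup>2, ipJ (z 1) (z 2) / ?k, 0, k\<^sub>0 z * k\<^sub>1 z]"
    by (simp add: vec_eq_4 1 2 3)
qed

text \<open>The determinant condition enters in the third row, where it fixes the sign; without it the
reflection of the third axis would give a second solution.\<close>

lemma is_frame_unique:
  assumes z: "cone_jet z" and g: "is_frame z g"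
  shows "g = frame_matrix z"
  unfolding matrix_eq
proof
  fix w
  let ?k = "normJ (z 1)"
  note k = cone_jet_normJ[OF z]
  note gz = frame_on_jet[OF assms]
  have O: "g \<in> O31" and d: "det g = 1"
    using g by (simp_all add: is_frame_def frame_form_det)
  have "ipJ (g *v z 0) (g *v w) = ipJ (z 0) w" "ipJ (g *v z 1) (g *v w) = ipJ (z 1) w"
    by (simp_all add: O31_ipJ[OF O])
  then have 1: "(g *v w) $ 1 = - ipJ (z 0) w" and 2: "(g *v w) $ 2 = ipJ (z 1) w / ?k"
    using k(1) unfolding gz by (simp_all add: ipJ_expand field_simps)
  have "det4 (z 0) (z 1) (z 2) w = det4 (g *v z 0) (g *v z 1) (g *v z 2) (g *v w)"
    by (simp add: det4_matrix d)
  also have "\<dots> = ?k ^ 3 * (g *v w) $ 3"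
    unfolding gz by (simp add: det4_expand power2_eq_square power3_eq_cube)
  finally have 3: "(g *v w) $ 3 = det4 (z 0) (z 1) (z 2) w / ?k ^ 3"
    using k(1) by simp
  have "g *v null_partner z = axis 1 1"
    using k(1) unfolding null_partner_def
    by (simp add: vec_eq_4 matrix_vector_mult_scaleR matrix_vector_mult_diff_distrib gz
        power2_eq_square k\<^sub>0_def del: One_nat_def)
  then have "ipJ (axis 1 1) (g *v w) = ipJ (null_partner z) w"
    by (metis O31_ipJ[OF O])
  then have 4: "(g *v w) $ 4 = - ipJ (null_partner z) w"
    by (simp add: ipJ_expand)
  show "g *v w = frame_matrix z *v w"
    unfolding frame_matrix_apply by (simp add: vec_eq_4 1 2 3 4)
qed

text \<open>The upper factor moves \<open>z\<^sub>0\<close> to a multiple of \<open>e\<^sub>4\<close>, the diagonal one rescales it and rotates the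
projection of \<open>z\<^sub>1\<close> to the second axis, and the two parameters of the lower factor remove the last
component of \<open>z\<^sub>1\<close> and the third component of \<open>z\<^sub>2\<close>.\<close>

lemma is_frame_exists:
  assumes "cone_jet z"
  shows "\<exists>g. is_frame z g"
proof -
  define a b c k where "a = z 0" "b = z 1" "c = z 2" "k = normJ (z 1)"
  note abc = this
  have k: "k > 0" "k\<^sup>2 = ipJ b b" using cone_jet_normJ[OF assms] by (simp_all add: abc)
  have a4: "a $ 4 > 0" and aa: "ipJ a a = 0" and ab: "ipJ a b = 0" and ac: "ipJ a c = - k\<^sup>2"
    using assms k by (simp_all add: cone_jet_def abc)
  define v :: "real^2" where "v = vector [- a$2 / a$4, - a$3 / a$4]"
  \<comment> \<open>The middle components of \<open>z\<^sub>1\<close> after the upper factor; their length is \<open>k\<close>.\<close>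
  define q1 q2 where "q1 = b$2 + v$1 * b$4" "q2 = b$3 + v$2 * b$4"
  note q = this
  define A :: "real^2^2" where "A = vector [vector [q1 / k, q2 / k], vector [- q2 / k, q1 / k]]"
  define \<xi> :: "real^2" where "\<xi> = vector [- b$4 / (a$4 * k),
      - (- q2 / k * (c$2 + v$1 * c$4) + q1 / k * (c$3 + v$2 * c$4)) / k\<^sup>2]"
  have \<xi>: "\<xi>$1 = - b$4 / (a$4 * k)"
      "\<xi>$2 = - (- q2 / k * (c$2 + v$1 * c$4) + q1 / k * (c$3 + v$2 * c$4)) / k\<^sup>2"
    by (simp_all add: \<xi>_def)
  define g where "g = lower_factor \<xi> ** diag_factor (a$4) A ** upper_factor v"
  have qq: "q1\<^sup>2 + q2\<^sup>2 = k\<^sup>2"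
    using ipJ_tangent_nonneg[OF aa ab] a4 by (simp add: k q v_def)
  then have qk: "q1 / k * (q1 / k) + q2 / k * (q2 / k) = 1"
    using k(1) by (simp add: field_simps power2_eq_square)
  have A: "rotation_matrix A"
    using qk by (simp add: rotation_matrix_def orthogonal_matrix A_def det_2 vec_eq_iff forall_2 sum_2
        matrix_matrix_mult_def transpose_def mat_def algebra_simps)
  have "a $ 4 \<noteq> 0 \<and> rotation_matrix A \<and> g = lower_factor \<xi> ** diag_factor (a$4) A ** upper_factor v"
    using A a4 g_def by simp
  then have "frame_form g"
    unfolding frame_form_def by blast
  moreover have "g \<in> O31"
    unfolding g_def using A a4 by (intro O31_mult factors_O31) auto
  ultimately have fg: "g \<in> O31" "frame_form g" by simp_all
  have U: "upper_factor v *v w = vector [- ipJ a w / a$4, w$2 + v$1 * w$4, w$3 + v$2 * w$4, w$4]" for w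
  proof -
    have v: "a$2 = - v$1 * a$4" "a$3 = - v$2 * a$4"
      using a4 by (simp_all add: v_def)
    have "(norm v)\<^sup>2 = (v$1)\<^sup>2 + (v$2)\<^sup>2"
      by (simp add: norm_vec_def L2_set_def sum_2)
    moreover have "(2 * a$1) * a$4 = (((v$1)\<^sup>2 + (v$2)\<^sup>2) * a$4) * a$4"
      using aa unfolding ipJ_expand v by (simp add: power2_eq_square algebra_simps)
    then have "2 * a$1 = ((v$1)\<^sup>2 + (v$2)\<^sup>2) * a$4"
      using a4 by simp
    ultimately have "a$1 = (norm v)\<^sup>2 / 2 * a$4"
      by simp
    then have "ipJ a w = - (w$1 + v$1 * w$2 + v$2 * w$3 + (norm v)\<^sup>2 / 2 * w$4) * a$4"
      unfolding ipJ_expand v by (simp add: algebra_simps)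
    then show ?thesis
      using a4 by (simp add: upper_factor_def vec_eq_4 matrix_vector_mult_4)
  qed
  have D: "diag_factor (a$4) A *v (upper_factor v *v w) = vector [- ipJ a w,
      q1 / k * (w$2 + v$1 * w$4) + q2 / k * (w$3 + v$2 * w$4),
      - q2 / k * (w$2 + v$1 * w$4) + q1 / k * (w$3 + v$2 * w$4), w$4 / a$4]" for w
    using a4 by (simp add: U diag_factor_def A_def vec_eq_4 matrix_vector_mult_4 divide_inverse)
  have g: "g *v w = lower_factor \<xi> *v vector [- ipJ a w,
      q1 / k * (w$2 + v$1 * w$4) + q2 / k * (w$3 + v$2 * w$4),
      - q2 / k * (w$2 + v$1 * w$4) + q1 / k * (w$3 + v$2 * w$4), w$4 / a$4]" for w
    unfolding g_def matrix_vector_mul_assoc[symmetric] D ..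
  have L: "lower_factor \<xi> *v vector [0, y, y', y''] = vector [0, y, y', \<xi>$1 * y + \<xi>$2 * y' + y'']" for y y' y''
    by (simp add: lower_factor_def vec_eq_4 matrix_vector_mult_4)
  have "g *v a = axis 4 1"
    using a4 unfolding g aa by (simp add: L v_def vec_eq_4)
  moreover have "g *v b = k *\<^sub>R axis 2 1"
  proof -
    have "q1 / k * q1 + q2 / k * q2 = k"
      using qq k(1) by (simp add: field_simps power2_eq_square)
    moreover have "- q2 / k * q1 + q1 / k * q2 = 0" by simp
    ultimately show ?thesis
      unfolding g ab q[symmetric] using k(1) a4 by (simp add: L \<xi> vec_eq_4)
  qed
  moreover have "(g *v c) $ 3 = 0"
    unfolding g ac using k(1) by (simp add: lower_factor_def matrix_vector_mult_4 \<xi>)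
  ultimately have "is_frame z g"
    using fg by (simp add: is_frame_def abc)
  then show ?thesis ..
qed

lemma is_frame_frame_matrix:
  assumes "cone_jet z"
  shows "is_frame z (frame_matrix z)"
  using is_frame_exists[OF assms] is_frame_unique[OF assms] by metis

lemma The_frame:
  assumes "cone_jet z"
  shows "(THE g. is_frame z g) = frame_matrix z"
  using is_frame_frame_matrix is_frame_unique assms by blast

text \<open>Replacing \<open>z\<^sub>3\<close> by the combination \<open>c\<close> of \<open>z\<^sub>3\<close> and \<open>z\<^sub>2\<close> that is orthogonal to \<open>z\<^sub>0\<close> changes the
determinant only by a factor; now \<open>det4_independent\<close> exchanges \<open>z\<^sub>2\<close>, which is transversal to that
hyperplane, for \<open>e\<^sub>1\<close>.\<close>

lemma k\<^sub>2_det4: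
  assumes z: "cone_jet z"
  shows "k\<^sub>2 z = det4 (z 0) (z 1) (z 2) (z 3) / normJ (z 1) ^ 5"
proof -
  let ?k = "normJ (z 1)" let ?s = "ipJ (z 1) (z 2)"
  define c where "c = ?k\<^sup>2 *\<^sub>R z 3 - (3 * ?s) *\<^sub>R z 2"
  note k = cone_jet_normJ[OF z]
  have z4: "z 0 $ 4 > 0" using z by (simp add: cone_jet_def)
  have "z 0 \<noteq> 0" using z4 by auto
  have ip: "ipJ (z 0) (z 0) = 0" "ipJ (z 1) (z 0) = 0" "ipJ (z 2) (z 0) = - ?k\<^sup>2"
      "ipJ (z 3) (z 0) = - 3 * ?s"
    using z by (simp_all add: cone_jet_def k ipJ_commute[of "z 1" "z 0"]
        ipJ_commute[of "z 2" "z 0"] ipJ_commute[of "z 3" "z 0"])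
  have "ipJ c (z 0) = 0"
    unfolding c_def by (simp add: ipJ.diff_left ipJ.scaleR_left ip)
  from det4_independent[OF \<open>z 0 \<noteq> 0\<close> ip(1,2) this, of "axis 1 1" "z 2"]
  have "- z 0 $ 4 * det4 (z 2) (z 0) (z 1) c = - ?k\<^sup>2 * det3 (z 0) (z 1) c"
    by (simp add: ip det4_axis1) (simp add: ipJ_expand)
  then have "z 0 $ 4 * det4 (z 0) (z 1) (z 2) c = ?k\<^sup>2 * det3 (z 0) (z 1) c"
    by (simp add: det4_rotate)
  moreover have "det4 (z 0) (z 1) (z 2) c = ?k\<^sup>2 * det4 (z 0) (z 1) (z 2) (z 3)"
    unfolding c_def det4_diff_scaleR det4_same by simp
  ultimately have "z 0 $ 4 * det4 (z 0) (z 1) (z 2) (z 3) = det3 (z 0) (z 1) c"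
    using k(1) by simp
  also have "\<dots> = ?k\<^sup>2 * det3 (z 0) (z 1) (z 3) - 3 * ?s * det3 (z 0) (z 1) (z 2)"
    unfolding c_def det4_axis1[symmetric] det4_diff_scaleR ..
  finally have "det4 (z 0) (z 1) (z 2) (z 3) =
      (?k\<^sup>2 * det3 (z 0) (z 1) (z 3) - 3 * ?s * det3 (z 0) (z 1) (z 2)) / z 0 $ 4"
    using z4 by (simp add: field_simps)
  then show ?thesis
    using k(1) z4 unfolding k\<^sub>2_def
    by (simp add: diff_divide_distrib) (simp add: divide_simps power_numeral_reduce)
qed

section \<open>The structure equation along a curve\<close>

lemma jet_of_nth: "jet_of u x n = nderiv n u x"
  by (simp add: jet_of_def)

lemma derivative_const_on_open:
  assumes "(f has_vector_derivative f') (at x)" "open S" "x \<in> S" "\<And>y. y \<in> S \<Longrightarrow> f y = c"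
  shows "f' = 0"
proof -
  have "(f has_vector_derivative 0) (at x)"
    by (rule has_vector_derivative_transform_within_open[OF has_vector_derivative_const assms(2,3)])
      (simp add: assms(4))
  with assms(1) show ?thesis by (rule vector_derivative_unique_at)
qed

text \<open>A non-radial curve is fixed, together with its derivatives \<open>Z n\<close> and its frame \<open>R\<close>.\<close>

locale light_curve =
  fixes S :: "real set" and u :: "real \<Rightarrow> real^4"
  assumes nonradial: "nonradial_curve S u"
begin

abbreviation Z :: "nat \<Rightarrow> real \<Rightarrow> real^4" where "Z n \<equiv> nderiv n u"

lemma open_S: "open S"
  and smooth: "smooth_curve_on S u"
  and on_cone: "x \<in> S \<Longrightarrow> ipJ (Z 0 x) (Z 0 x) = 0"
  and height: "x \<in> S \<Longrightarrow> Z 0 x $ 4 > 0"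
  and speed: "x \<in> S \<Longrightarrow> normJ (Z 1 x) \<noteq> 0"
proof -
  show "open S" "smooth_curve_on S u" "x \<in> S \<Longrightarrow> normJ (Z 1 x) \<noteq> 0"
    using nonradial nderiv_Suc[of 0 u] by (auto simp: nonradial_curve_def One_nat_def nderiv_0)
  assume "x \<in> S"
  then have "u x $ 1 + u x $ 4 > 0" "u x $ 4 \<noteq> 0" and c: "ipJ (u x) (u x) = 0"
    using nonradial by (auto simp: nonradial_curve_def upper_light_cone_def light_cone_def)
  moreover have "2 * (u x $ 1 * u x $ 4) = (u x $ 2)\<^sup>2 + (u x $ 3)\<^sup>2"
    using c by (simp add: ipJ_expand power2_eq_square)
  then have "u x $ 1 * u x $ 4 \<ge> 0"
    by (smt (verit) zero_le_power2)
  ultimately show "Z 0 x $ 4 > 0"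
    unfolding nderiv_0 by (smt (verit) mult_pos_neg mult_nonneg_nonpos zero_le_mult_iff)
  from c show "ipJ (Z 0 x) (Z 0 x) = 0" by (simp add: nderiv_0)
qed

lemma Z_derivative: "x \<in> S \<Longrightarrow> (Z n has_vector_derivative Z (Suc n) x) (at x)"
  using smooth by (rule smooth_curve_on_derivative)

lemma ipJ_derivative:
  assumes "x \<in> S"
  shows "((\<lambda>y. ipJ (Z m y) (Z n y)) has_vector_derivative
    ipJ (Z m x) (Z (Suc n) x) + ipJ (Z (Suc m) x) (Z n x)) (at x)"
  using assms by (intro ipJ.has_vector_derivative Z_derivative)

lemma cone_jet_jet_of:
  assumes "x \<in> S" shows "cone_jet (jet_of u x)"
proof -
  have 1: "ipJ (Z 0 x) (Z 1 x) = 0" if "x \<in> S" for x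
    using derivative_const_on_open[OF ipJ_derivative[OF that] open_S that, of 0 0 0] on_cone
    by (simp add: ipJ_commute[of "Z (Suc 0) x"] One_nat_def)
  have 2: "ipJ (Z 0 x) (Z 2 x) + ipJ (Z 1 x) (Z 1 x) = 0" if "x \<in> S" for x
    using derivative_const_on_open[OF ipJ_derivative[OF that] open_S that, of 0 1 0] 1
    by (simp add: numeral_2_eq_2 One_nat_def)
  have "ipJ (Z 0 x) (Z 3 x) + ipJ (Z 1 x) (Z 2 x) + (ipJ (Z 1 x) (Z 2 x) + ipJ (Z 2 x) (Z 1 x)) = 0"
  proof (rule derivative_const_on_open[OF _ open_S assms])
    show "((\<lambda>x. ipJ (Z 0 x) (Z 2 x) + ipJ (Z 1 x) (Z 1 x)) has_vector_derivative
      ipJ (Z 0 x) (Z 3 x) + ipJ (Z 1 x) (Z 2 x) + (ipJ (Z 1 x) (Z 2 x) + ipJ (Z 2 x) (Z 1 x))) (at x)"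
      using has_vector_derivative_add[OF ipJ_derivative[OF assms, of 0 2]
          ipJ_derivative[OF assms, of 1 1]]
      by (simp add: numeral_3_eq_3 numeral_2_eq_2 One_nat_def)
  qed (rule 2)
  moreover have "ipJ (Z 1 x) (Z 1 x) > 0"
  proof -
    have "ipJ (Z 1 x) (Z 1 x) \<ge> 0"
      using ipJ_tangent_nonneg[OF on_cone[OF assms] 1[OF assms]] height[OF assms] by simp
    moreover have "ipJ (Z 1 x) (Z 1 x) \<noteq> 0"
      using speed[OF assms] by (auto simp: normJ_def)
    ultimately show ?thesis by simp
  qed
  ultimately show ?thesis
    using on_cone[OF assms] height[OF assms] 1[OF assms] 2[OF assms]
    by (simp add: cone_jet_def jet_of_nth ipJ_commute[of "Z 2 x" "Z 1 x"])
qed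

abbreviation R :: "real \<Rightarrow> real^4^4" where "R y \<equiv> frame_matrix (jet_of u y)"

lemma is_frame_R: "y \<in> S \<Longrightarrow> is_frame (jet_of u y) (R y)"
  by (simp add: is_frame_frame_matrix cone_jet_jet_of)

lemma R_O31: "y \<in> S \<Longrightarrow> R y \<in> O31"
  using is_frame_R by (simp add: is_frame_def)

lemma smooth_expr_component: "smooth_expr S (\<lambda>y. Z n y $ i)"
  by (intro smooth_expr.smooth smooth_curve_on_component open_S smooth)

lemma smooth_expr_ipJ: "smooth_expr S (\<lambda>y. ipJ (Z m y) (Z n y))"
  "smooth_expr S (\<lambda>y. ipJ (Z m y) w)"
  unfolding ipJ_expand
  by (intro smooth_expr_diff smooth_expr.add smooth_expr.mult smooth_expr_component
      smooth_expr.const)+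

lemma smooth_expr_det4: "smooth_expr S (\<lambda>y. det4 (Z l y) (Z m y) (Z n y) w)"
  "smooth_expr S (\<lambda>y. det4 w (Z l y) (Z m y) (Z n y))"
  unfolding det4_expand
  by (intro smooth_expr_diff smooth_expr.add smooth_expr.mult smooth_expr_component
      smooth_expr.const)+

lemma smooth_expr_normJ: "smooth_expr S (\<lambda>y. normJ (Z 1 y))"
  unfolding normJ_def
  using cone_jet_jet_of by (intro smooth_expr.sqrt smooth_expr_ipJ) (auto simp: cone_jet_def jet_of_nth)

lemma normJ_pos: "y \<in> S \<Longrightarrow> normJ (Z 1 y) > 0"
  using cone_jet_normJ(1)[OF cone_jet_jet_of] by (simp add: jet_of_nth)

lemmas smooth_expr_intros = smooth_expr_diff smooth_expr.add smooth_expr.mult smooth_expr_divide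
  smooth_expr_power smooth_expr_uminus smooth_expr_ipJ smooth_expr_det4 smooth_expr_normJ
  smooth_expr.const smooth_expr_component

lemma smooth_invariants:
  "smooth_expr S (\<lambda>y. k\<^sub>0 (jet_of u y))"
  "smooth_expr S (\<lambda>y. k\<^sub>1 (jet_of u y))"
  "smooth_expr S (\<lambda>y. k\<^sub>2 (jet_of u y))"
proof -
  have "\<forall>y\<in>S. normJ (Z 1 y) \<noteq> 0" "\<forall>y\<in>S. Z 0 y $ 4 \<noteq> 0"
    using normJ_pos height by fastforce+
  then show "smooth_expr S (\<lambda>y. k\<^sub>0 (jet_of u y))" "smooth_expr S (\<lambda>y. k\<^sub>1 (jet_of u y))"
      "smooth_expr S (\<lambda>y. k\<^sub>2 (jet_of u y))"
    unfolding k\<^sub>0_def k\<^sub>1_def k\<^sub>2_def jet_of_nth det4_axis1[symmetric]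
    by (intro smooth_expr_intros; simp)+
qed

lemma smooth_R: "smooth_curve_on S R"
proof (intro smooth_curve_on_componentwise open_S)
  fix i j
  have nz: "\<forall>y\<in>S. normJ (Z 1 y) \<noteq> 0"
    using normJ_pos by fastforce
  have "R y $ i $ j = (R y *v axis j 1) $ i" for y
    by (simp add: matrix_vector_mult_basis column_def)
  moreover have "smooth_expr S (\<lambda>y. (R y *v axis j 1) $ i)"
    using exhaust_4[of i] nz
    by (auto simp: frame_matrix_apply null_partner_def jet_of_nth ipJ.scaleR_left ipJ.diff_left
        intro!: smooth_expr_intros smooth_invariants)
  ultimately show "smooth_curve_on S (\<lambda>y. R y $ i $ j)"
    by (simp add: smooth_expr_imp_smooth_curve_on open_S)
qed

lemma R_derivative: "y \<in> S \<Longrightarrow> (R has_vector_derivative nderiv 1 R y) (at y)"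
  using smooth_curve_on_derivative[OF smooth_R, of y 0] by (simp add: One_nat_def nderiv_0)

lemma moving_derivative:
  assumes "x \<in> S"
  shows "((\<lambda>y. R y *v Z n y) has_vector_derivative
    R x *v Z (Suc n) x + nderiv 1 R x *v Z n x) (at x)"
  using assms
  by (intro bounded_bilinear.has_vector_derivative[OF bounded_bilinear_matrix_vector_mult]
      R_derivative Z_derivative)

end

definition mc_matrix :: "real \<Rightarrow> real \<Rightarrow> real \<Rightarrow> real^4^4" where
  "mc_matrix k0 k1 k2 = vector [vector [0, - k0, 0, 0], vector [- k1, 0, 0, - k0],
     vector [- k2, 0, 0, 0], vector [0, - k1, - k2, 0]]"

text \<open>A matrix that is skew for the Lorentzian form has six free entries.  The fourth column, the
second column and one entry of the first determine all of them.  In the application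
\<open>c\<close> is the derivative of the speed and \<open>s\<close> the second component of \<open>g z\<^sub>2\<close>.\<close>

lemma skew_eq_mc_matrix:
  assumes skew: "\<And>c d. ipJ (M *v c) d + ipJ c (M *v d) = 0"
    and 4: "M *v axis 4 1 = - k0 *\<^sub>R axis 2 1"
    and 2: "k0 *\<^sub>R (M *v axis 2 1) = c *\<^sub>R axis 2 1 - vector [k0\<^sup>2, s, 0, k0 * k1]"
    and 3: "(M *v vector [k0\<^sup>2, s, 0, k0 * k1]) $ 3 = - k0\<^sup>2 * k2"
    and k0: "k0 \<noteq> 0"
  shows "M = mc_matrix k0 k1 k2"
proof -
  have c4: "M$1$4 = 0" "M$2$4 = - k0" "M$3$4 = 0" "M$4$4 = 0"
    using 4 by (simp_all add: vec_eq_4 matrix_vector_mult_4)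
  have "k0 * M$1$2 = k0 * - k0" "M$3$2 = 0" "k0 * M$4$2 = k0 * - k1"
    using 2 k0 by (simp_all add: vec_eq_4 matrix_vector_mult_4 power2_eq_square)
  then have c2: "M$1$2 = - k0" "M$3$2 = 0" "M$4$2 = - k1"
    using k0 unfolding mult_cancel_left by simp_all
  have "k0\<^sup>2 * M$3$1 = k0\<^sup>2 * - k2"
    using 3 by (simp add: matrix_vector_mult_4 c4 c2 mult.commute)
  then have "M$3$1 = - k2"
    using k0 unfolding mult_cancel_left by simp
  moreover note skew[of "axis 1 1" "axis 1 1"] skew[of "axis 1 1" "axis 2 1"]
    skew[of "axis 1 1" "axis 3 1"] skew[of "axis 1 1" "axis 4 1"]
    skew[of "axis 2 1" "axis 2 1"] skew[of "axis 2 1" "axis 3 1"]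
    skew[of "axis 3 1" "axis 3 1"] skew[of "axis 3 1" "axis 4 1"]
  ultimately show ?thesis
    by (simp add: ipJ_expand matrix_vector_mult_4 c4 c2 vec_eq_4 mc_matrix_def)
qed

text \<open>Each normalization \<open>R Z\<^sub>n = w\<^sub>n\<close> gives \<open>M w\<^sub>n = w\<^sub>n' - R Z\<^sub>n\<^sub>+\<^sub>1\<close> for \<open>M = R' R\<^sup>-\<^sup>1\<close>: the case \<open>n = 0\<close> is
the fourth column, \<open>n = 1\<close> the second, and the third component for \<open>n = 2\<close> is the entry that carries
\<open>k\<^sub>2\<close>.  Skewness of \<open>M\<close> is the derivative of the isometry property of \<open>R\<close>.\<close>

theorem (in light_curve) frame_structure_equation:
  assumes x: "x \<in> S"
  shows "nderiv 1 R x = mc_matrix (k\<^sub>0 (jet_of u x)) (k\<^sub>1 (jet_of u x)) (k\<^sub>2 (jet_of u x)) ** R x"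
proof -
  have fj: "R y *v Z 0 y = axis 4 1" "R y *v Z 1 y = normJ (Z 1 y) *\<^sub>R axis 2 1"
      "R y *v Z 2 y = vector [(normJ (Z 1 y))\<^sup>2, ipJ (Z 1 y) (Z 2 y) / normJ (Z 1 y), 0,
         k\<^sub>0 (jet_of u y) * k\<^sub>1 (jet_of u y)]" if "y \<in> S" for y
    using frame_on_jet[OF cone_jet_jet_of is_frame_R, OF that that] by (simp_all add: jet_of_nth)
  let ?z = "jet_of u x" let ?k0 = "k\<^sub>0 ?z" let ?k1 = "k\<^sub>1 ?z" let ?k2 = "k\<^sub>2 ?z"
  define M where "M = nderiv 1 R x ** matrix_inv (R x)"
  have M: "nderiv 1 R x *v w = M *v (R x *v w)" for w
    unfolding M_def matrix_vector_mul_assoc[symmetric] by (simp add: O31_inv(4) R_O31 x)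
  have k0: "?k0 = normJ (Z 1 x)" "?k0 > 0"
    using normJ_pos[OF x] by (simp_all add: k\<^sub>0_def jet_of_nth)
  have skew: "ipJ (M *v c) d + ipJ c (M *v d) = 0" for c d
  proof -
    let ?a = "matrix_inv (R x) *v c" and ?b = "matrix_inv (R x) *v d"
    have der: "((\<lambda>y. R y *v w) has_vector_derivative nderiv 1 R x *v w) (at x)" for w
      using bounded_bilinear.has_vector_derivative[OF bounded_bilinear_matrix_vector_mult
          R_derivative[OF x] has_vector_derivative_const[of w]] by simp
    have "ipJ (R x *v ?a) (nderiv 1 R x *v ?b) + ipJ (nderiv 1 R x *v ?a) (R x *v ?b) = 0"
      by (rule derivative_const_on_open[OF ipJ.has_vector_derivative[OF der der] open_S x])
        (simp add: O31_ipJ R_O31)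
    then show ?thesis by (simp add: M O31_inv(5) R_O31 x)
  qed
  have Z2: "R x *v Z 2 x = vector [?k0\<^sup>2, ipJ (Z 1 x) (Z 2 x) / ?k0, 0, ?k0 * ?k1]"
    using fj(3)[OF x] by (simp add: k0)
  have 4: "M *v axis 4 1 = - ?k0 *\<^sub>R axis 2 1"
  proof -
    have "R x *v Z 1 x + nderiv 1 R x *v Z 0 x = 0"
      using derivative_const_on_open[OF moving_derivative[OF x] open_S x, of 0] fj(1)
      by (simp add: One_nat_def)
    then show ?thesis
      using fj(1,2)[OF x] by (simp add: M k0 add_eq_0_iff)
  qed
  obtain c where c: "((\<lambda>y. normJ (Z 1 y)) has_real_derivative c) (at x)"
    using smooth_expr_derivative[OF open_S smooth_expr_normJ] x by blast
  have 2: "?k0 *\<^sub>R (M *v axis 2 1) =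
      c *\<^sub>R axis 2 1 - vector [?k0\<^sup>2, ipJ (Z 1 x) (Z 2 x) / ?k0, 0, ?k0 * ?k1]"
  proof -
    have "((\<lambda>y. normJ (Z 1 y) *\<^sub>R axis 2 1) has_vector_derivative c *\<^sub>R axis (2::4) (1::real)) (at x)"
      using c by (auto intro!: derivative_eq_intros simp: has_real_derivative_iff_has_vector_derivative)
    then have "((\<lambda>y. R y *v Z 1 y) has_vector_derivative c *\<^sub>R axis 2 1) (at x)"
      by (rule has_vector_derivative_transform_within_open[OF _ open_S x]) (simp add: fj(2))
    with moving_derivative[OF x, of 1]
    have "R x *v Z 2 x + nderiv 1 R x *v Z 1 x = c *\<^sub>R axis 2 1"
      using vector_derivative_unique_at by (fastforce simp: numeral_2_eq_2 One_nat_def)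
    then show ?thesis
      unfolding M fj(2)[OF x] Z2 by (simp add: k0 matrix_vector_mult_scaleR algebra_simps)
  qed
  have 3: "(M *v vector [?k0\<^sup>2, ipJ (Z 1 x) (Z 2 x) / ?k0, 0, ?k0 * ?k1]) $ 3 = - ?k0\<^sup>2 * ?k2"
  proof -
    have "((\<lambda>y. (R y *v Z 2 y) $ 3) has_vector_derivative
        (R x *v Z 3 x + nderiv 1 R x *v Z 2 x) $ 3) (at x)"
      using bounded_linear.has_vector_derivative[OF bounded_linear_vec_nth moving_derivative[OF x, of 2]]
      by (simp add: numeral_3_eq_3 numeral_2_eq_2)
    from derivative_const_on_open[OF this open_S x, of 0] fj(3)
    have "(M *v (R x *v Z 2 x)) $ 3 = - (R x *v Z 3 x) $ 3"
      by (simp add: M)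
    also have "\<dots> = - ?k0\<^sup>2 * ?k2"
      using k0 unfolding k\<^sub>2_det4[OF cone_jet_jet_of[OF x]] frame_matrix_apply jet_of_nth
      by (simp add: power_numeral_reduce)
    finally show ?thesis unfolding Z2 .
  qed
  have "M = mc_matrix ?k0 ?k1 ?k2"
    using skew_eq_mc_matrix[OF skew 4 2 3] k0 by simp
  then show ?thesis
    using M by (simp add: matrix_eq flip: matrix_vector_mul_assoc)
qed

theorem (in light_curve) moving_frame_of_curve:
  assumes x: "x \<in> S"
  shows "\<rho>\<^sub>L u differentiable (at x)"
    and "right_maurer_cartan (\<rho>\<^sub>L u) x =
      mc_matrix (k\<^sub>0 (jet_of u x)) (k\<^sub>1 (jet_of u x)) (k\<^sub>2 (jet_of u x))"
proof -
  have \<rho>: "\<rho>\<^sub>L u y = R y" if "y \<in> S" for y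
    unfolding \<rho>\<^sub>L_def by (rule The_frame[OF cone_jet_jet_of[OF that]])
  have der: "(\<rho>\<^sub>L u has_vector_derivative nderiv 1 R x) (at x)"
    by (rule has_vector_derivative_transform_within_open[OF R_derivative[OF x] open_S x])
      (simp add: \<rho>)
  then show "\<rho>\<^sub>L u differentiable (at x)" by (rule differentiableI_vector)
  show "right_maurer_cartan (\<rho>\<^sub>L u) x =
      mc_matrix (k\<^sub>0 (jet_of u x)) (k\<^sub>1 (jet_of u x)) (k\<^sub>2 (jet_of u x))"
    unfolding right_maurer_cartan_def vector_derivative_at[OF der] \<rho>[OF x]
      frame_structure_equation[OF x]
    by (simp add: O31_inv(2) R_O31 x flip: matrix_mul_assoc)
qed

section \<open>Reconstructing a jet from its invariants\<close>

text \<open>Differential polynomials in three functions: \<open>Coord n i\<close> stands for the \<open>n\<close>-th derivative of the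
\<open>i\<close>-th function.  Syntactic polynomials make the total derivative a total operation that can be
iterated, while their values are visibly smooth and of finite order.\<close>

datatype dpoly = Coord nat 3 | Const real | Add dpoly dpoly | Times dpoly dpoly

primrec dvalue :: "dpoly \<Rightarrow> (nat \<Rightarrow> real^3) \<Rightarrow> real" where
  "dvalue (Coord n i) \<kappa> = \<kappa> n $ i"
| "dvalue (Const c) \<kappa> = c"
| "dvalue (Add p q) \<kappa> = dvalue p \<kappa> + dvalue q \<kappa>"
| "dvalue (Times p q) \<kappa> = dvalue p \<kappa> * dvalue q \<kappa>"

primrec total_derivative :: "dpoly \<Rightarrow> dpoly" where
  "total_derivative (Coord n i) = Coord (Suc n) i"
| "total_derivative (Const c) = Const 0"
| "total_derivative (Add p q) = Add (total_derivative p) (total_derivative q)"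
| "total_derivative (Times p q) = Add (Times (total_derivative p) q) (Times (total_derivative q) p)"

primrec dorder :: "dpoly \<Rightarrow> nat" where
  "dorder (Coord n i) = n"
| "dorder (Const c) = 0"
| "dorder (Add p q) = max (dorder p) (dorder q)"
| "dorder (Times p q) = max (dorder p) (dorder q)"

lemma dvalue_derivative:
  assumes "\<And>n. ((\<lambda>y. I y n) has_vector_derivative I x (Suc n)) (at x)"
  shows "((\<lambda>y. dvalue p (I y)) has_real_derivative dvalue (total_derivative p) (I x)) (at x)"
proof (induction p)
  case (Coord n i)
  show ?case
    using bounded_linear.has_vector_derivative[OF bounded_linear_vec_nth assms]
    by (simp add: has_real_derivative_iff_has_vector_derivative)
qed (auto intro: DERIV_add DERIV_mult)

lemma dvalue_cong: "(\<And>n. n \<le> dorder p \<Longrightarrow> \<kappa> n = \<kappa>' n) \<Longrightarrow> dvalue p \<kappa> = dvalue p \<kappa>'"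
  by (induction p) auto

lemma Cr_on_dvalue: "Cr_on r UNIV (dvalue p)"
proof (induction p)
  case (Coord n i)
  have "dvalue (Coord n i) = (\<lambda>\<kappa>. \<kappa> n \<bullet> axis i 1)"
    by (simp add: fun_eq_iff inner_axis)
  then show ?case by (simp only: Cr_on_coordinate)
next
  case (Const c)
  have "dvalue (Const c) = (\<lambda>\<kappa>. c)" by (simp add: fun_eq_iff)
  then show ?case by (simp only: Cr_on_const)
next
  case (Add p q)
  have "dvalue (Add p q) = (\<lambda>\<kappa>. dvalue p \<kappa> + dvalue q \<kappa>)" by (simp add: fun_eq_iff)
  then show ?case using Cr_on_add[OF open_UNIV Add] by simp
next
  case (Times p q)
  have "dvalue (Times p q) = (\<lambda>\<kappa>. dvalue p \<kappa> * dvalue q \<kappa>)" by (simp add: fun_eq_iff)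
  then show ?case using Cr_on_mult[OF open_UNIV Times] by simp
qed

text \<open>The recursion \<open>w\<^sub>n\<^sub>+\<^sub>1 = D w\<^sub>n - K w\<^sub>n\<close>, \<open>w\<^sub>0 = e\<^sub>4\<close>, by components; \<open>Coord 0 1\<close>, \<open>Coord 0 2\<close> and
\<open>Coord 0 3\<close> are \<open>k\<^sub>0\<close>, \<open>k\<^sub>1\<close> and \<open>k\<^sub>2\<close>.\<close>

primrec moving_jet :: "nat \<Rightarrow> 4 \<Rightarrow> dpoly" where
  "moving_jet 0 i = Const (if i = 4 then 1 else 0)"
| "moving_jet (Suc n) i = Add (total_derivative (moving_jet n i))
    (if i = 1 then Times (Coord 0 1) (moving_jet n 2)
     else if i = 2 then Add (Times (Coord 0 2) (moving_jet n 1)) (Times (Coord 0 1) (moving_jet n 4))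
     else if i = 3 then Times (Coord 0 3) (moving_jet n 1)
     else Add (Times (Coord 0 2) (moving_jet n 2)) (Times (Coord 0 3) (moving_jet n 3)))"

definition normal_form :: "(nat \<Rightarrow> real^3) \<Rightarrow> nat \<Rightarrow> real^4" where
  "normal_form \<kappa> n = (\<chi> i. dvalue (moving_jet n i) \<kappa>)"

lemma normal_form_derivative:
  assumes "\<And>n. ((\<lambda>y. I y n) has_vector_derivative I x (Suc n)) (at x)"
  shows "((\<lambda>y. normal_form (I y) n) has_vector_derivative
    normal_form (I x) (Suc n) + mc_matrix (I x 0 $ 1) (I x 0 $ 2) (I x 0 $ 3) *v normal_form (I x) n) (at x)"
proof (rule has_vector_derivative_componentwise)
  fix i
  have "dvalue (total_derivative (moving_jet n i)) (I x) =
      (normal_form (I x) (Suc n) + mc_matrix (I x 0 $ 1) (I x 0 $ 2) (I x 0 $ 3) *v normal_form (I x) n) $ i"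
    using exhaust_4[of i]
    by (elim disjE) (simp_all add: normal_form_def mc_matrix_def matrix_vector_mult_4)
  note eq = this
  have nf: "normal_form (I y) n $ i = dvalue (moving_jet n i) (I y)" for y
    by (simp add: normal_form_def)
  show "((\<lambda>y. normal_form (I y) n $ i) has_vector_derivative
      (normal_form (I x) (Suc n) + mc_matrix (I x 0 $ 1) (I x 0 $ 2) (I x 0 $ 3) *v normal_form (I x) n) $ i) (at x)"
    unfolding nf eq[symmetric] has_real_derivative_iff_has_vector_derivative[symmetric]
    by (rule dvalue_derivative[of I x, OF assms])
qed

context light_curve
begin

lemma invariant_jet_derivative:
  assumes "x \<in> S"
  shows "((\<lambda>y. invariant_jet u y n) has_vector_derivative invariant_jet u x (Suc n)) (at x)"
proof -
  let ?k = "\<lambda>y. vector [k\<^sub>0 (jet_of u y), k\<^sub>1 (jet_of u y), k\<^sub>2 (jet_of u y)] :: real^3"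
  have "smooth_curve_on S ?k"
  proof (intro smooth_curve_on_componentwise open_S)
    fix i :: 3
    show "smooth_curve_on S (\<lambda>y. ?k y $ i)"
      using exhaust_3[of i]
      by (elim disjE) (simp_all add: smooth_invariants smooth_expr_imp_smooth_curve_on open_S)
  qed
  from smooth_curve_on_derivative[OF this assms, of n] show ?thesis
    unfolding invariant_jet_def .
qed

text \<open>Differentiating \<open>R Z\<^sub>n = w\<^sub>n\<close> and inserting the structure equation leaves the defining recursion
for \<open>R Z\<^sub>n\<^sub>+\<^sub>1\<close>.\<close>

theorem frame_times_jet_eq_normal_form:
  "x \<in> S \<Longrightarrow> R x *v Z n x = normal_form (invariant_jet u x) n"
proof (induction n arbitrary: x)
  case 0
  have "normal_form (invariant_jet u x) 0 = axis 4 1"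
    by (simp add: normal_form_def vec_eq_4)
  with frame_on_jet(1)[OF cone_jet_jet_of is_frame_R, OF 0 0] show ?case
    by (metis jet_of_nth)
next
  case (Suc n)
  let ?I = "invariant_jet u x"
  let ?K = "mc_matrix (k\<^sub>0 (jet_of u x)) (k\<^sub>1 (jet_of u x)) (k\<^sub>2 (jet_of u x))"
  have I0: "?I 0 $ 1 = k\<^sub>0 (jet_of u x)" "?I 0 $ 2 = k\<^sub>1 (jet_of u x)" "?I 0 $ 3 = k\<^sub>2 (jet_of u x)"
    by (simp_all add: invariant_jet_def nderiv_0)
  have "((\<lambda>y. normal_form (invariant_jet u y) n) has_vector_derivative
      normal_form ?I (Suc n) + ?K *v normal_form ?I n) (at x)"
    using normal_form_derivative[of "invariant_jet u" x n,
        OF invariant_jet_derivative[OF Suc.prems]] unfolding I0 .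
  then have "((\<lambda>y. R y *v Z n y) has_vector_derivative
      normal_form ?I (Suc n) + ?K *v normal_form ?I n) (at x)"
    by (rule has_vector_derivative_transform_within_open[OF _ open_S Suc.prems]) (simp add: Suc.IH)
  from vector_derivative_unique_at[OF this moving_derivative[OF Suc.prems]]
  show ?case
    by (simp add: frame_structure_equation[OF Suc.prems] Suc.IH[OF Suc.prems]
        flip: matrix_vector_mul_assoc)
qed

text \<open>A group element may leave the upper cone or reach the ray where the last coordinate vanishes.
If it does not do so at \<open>x\<close>, it does not do so near \<open>x\<close>, and the jet only sees the curve near \<open>x\<close>.\<close>

lemma prolong_in_jet_space:
  assumes "x \<in> S" and g: "g \<in> O31"
    and up: "(g *v u x) $ 1 + (g *v u x) $ 4 > 0" "(g *v u x) $ 4 \<noteq> 0"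
  shows "prolong g (jet_of u x) \<in> jet_space"
proof -
  let ?v = "\<lambda>y. g *v u y"
  let ?F = "\<lambda>n y. g *v Z n y"
  define T where "T = S \<inter> ?v -` {w. w $ 1 + w $ 4 > 0 \<and> w $ 4 \<noteq> 0}"
  have F: "(?F n has_vector_derivative ?F (Suc n) y) (at y)" if "y \<in> S" for n y
    using bounded_linear.has_vector_derivative[OF matrix_vector_mul_bounded_linear Z_derivative[OF that]] .
  have n: "nderiv n ?v y = ?F n y" if "y \<in> S" for n y
    by (rule nderiv_unique[of S ?F ?v, OF open_S F _ that]) (simp_all add: nderiv_0)
  have "continuous_on S (?F 0)"
    using F has_vector_derivative_continuous continuous_at_imp_continuous_on by metis
  moreover have "open {w::real^4. w $ 1 + w $ 4 > 0 \<and> w $ 4 \<noteq> 0}"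
    by (intro open_Collect_conj open_Collect_less open_Collect_neq continuous_intros)
  ultimately have "open T"
    unfolding T_def nderiv_0 by (rule continuous_open_preimage[OF _ open_S])
  have "nonradial_curve T ?v"
    unfolding nonradial_curve_def
  proof (intro conjI ballI)
    show "smooth_curve_on T ?v"
      by (rule smooth_curve_onI[OF \<open>open T\<close>, of ?F]) (use F in \<open>auto simp: T_def nderiv_0\<close>)
    fix y assume "y \<in> T"
    then have y: "y \<in> S" "?v y $ 1 + ?v y $ 4 > 0" "?v y $ 4 \<noteq> 0" by (auto simp: T_def)
    then show "?v y \<in> upper_light_cone" "?v y $ 4 \<noteq> 0"
      using on_cone by (auto simp: upper_light_cone_def light_cone_def O31_ipJ g nderiv_0)
    have "vector_derivative ?v (at y) = g *v Z 1 y"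
      using n[OF y(1), of 1] by (simp add: nderiv_Suc One_nat_def nderiv_0)
    then show "normJ (vector_derivative ?v (at y)) \<noteq> 0"
      using speed[OF y(1)] by (simp add: O31_normJ g)
  qed fact
  moreover have "x \<in> T" using assms by (simp add: T_def)
  moreover have "prolong g (jet_of u x) = jet_of ?v x"
    using n[OF assms(1)] by (simp add: prolong_def jet_of_def)
  ultimately show ?thesis unfolding jet_space_def by blast
qed

end

section \<open>Differential invariants\<close>

lemma jet_spaceE:
  assumes "z \<in> jet_space"
  obtains S u x where "light_curve S u" "x \<in> S" "z = jet_of u x"
  using assms by (auto simp: jet_space_def light_curve_def)

lemma jet_space_cone_jet: "z \<in> jet_space \<Longrightarrow> cone_jet z"
  by (metis jet_spaceE light_curve.cone_jet_jet_of)

text \<open>Elements of the group have determinant 1 or -1, so positivity of the determinant is an open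
condition that selects determinant 1.\<close>

lemma differential_invariant_jet_spaceI:
  assumes order: "\<And>z w. (\<And>n. n \<le> 3 \<Longrightarrow> z n = w n) \<Longrightarrow> f z = f w"
    and inv: "\<And>g z. g \<in> O31 \<Longrightarrow> det g = 1 \<Longrightarrow> cone_jet z \<Longrightarrow> cone_jet (prolong g z) \<Longrightarrow>
      f (prolong g z) = f z"
  shows "differential_invariant jet_space f"
  unfolding differential_invariant_def
proof (intro conjI ballI)
  show "finite_order_on jet_space f"
    unfolding finite_order_on_def
  proof (intro exI ballI impI)
    fix z w :: jet assume "\<forall>n\<le>3. z n = w n"
    then show "f z = f w" by (intro order) simp
  qed
  fix z\<^sub>0 assume "z\<^sub>0 \<in> jet_space"
  let ?V = "{g :: real^4^4. det g > 0}"
  have "open ?V"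
    unfolding det_4 by (intro open_Collect_less continuous_intros)
  moreover have "mat 1 \<in> ?V" by simp
  moreover have "f (prolong g z) = f z"
    if "g \<in> O31 \<inter> ?V" "z \<in> jet_space \<inter> UNIV" "prolong g z \<in> jet_space" for g z
    using that O31_det[of g] by (intro inv jet_space_cone_jet) auto
  ultimately show "\<exists>U V. open U \<and> z\<^sub>0 \<in> U \<and> open V \<and> mat 1 \<in> V \<and>
      (\<forall>g\<in>O31 \<inter> V. \<forall>z\<in>jet_space \<inter> U. prolong g z \<in> jet_space \<longrightarrow> f (prolong g z) = f z)"
    by (intro exI[of _ UNIV] exI[of _ ?V] conjI ballI impI) simp_all
qed simp

lemma differential_invariants:
  "differential_invariant jet_space k\<^sub>0"
  "differential_invariant jet_space k\<^sub>1"
  "differential_invariant jet_space k\<^sub>2"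
proof -
  show "differential_invariant jet_space k\<^sub>0" "differential_invariant jet_space k\<^sub>1"
    by (rule differential_invariant_jet_spaceI;
        simp add: k\<^sub>0_def k\<^sub>1_def prolong_def O31_normJ O31_ipJ)+
  show "differential_invariant jet_space k\<^sub>2"
  proof (rule differential_invariant_jet_spaceI)
    show "k\<^sub>2 (prolong g z) = k\<^sub>2 z"
      if "g \<in> O31" "det g = 1" "cone_jet z" "cone_jet (prolong g z)" for g z
      using that by (simp add: k\<^sub>2_det4) (simp add: prolong_def O31_normJ det4_matrix)
  qed (simp add: k\<^sub>2_def)
qed

section \<open>Functional generation\<close>

lemma continuous_on_nth: "continuous_on A (\<lambda>z :: jet. z n)"
  by (rule continuous_on_subset[OF continuous_on_product_coordinates]) simp

lemma continuous_on_frame_matrix: "continuous_on {z. ipJ (z 1) (z 1) > 0} frame_matrix"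
proof -
  let ?A = "{z :: jet. ipJ (z 1) (z 1) > 0}"
  have ip: "continuous_on ?A (\<lambda>z. ipJ (z m) (z n))" "continuous_on ?A (\<lambda>z. ipJ (z m) w)" for m n w
    by (intro ipJ.continuous_on continuous_on_nth continuous_on_const)+
  have nrm: "continuous_on ?A (\<lambda>z. normJ (z 1))"
    unfolding normJ_def by (intro continuous_on_real_sqrt ip)
  have d: "continuous_on ?A (\<lambda>z. det4 (z 0) (z 1) (z 2) w)" for w
    unfolding det4_expand by (intro continuous_intros continuous_on_nth)
  have nz: "\<forall>z\<in>?A. normJ (z 1) \<noteq> 0" by (simp add: normJ_def)
  have "continuous_on ?A (\<lambda>z. frame_matrix z $ i $ j)" for i j
  proof -
    have "frame_matrix z $ i $ j = (frame_matrix z *v axis j 1) $ i" for z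
      by (simp add: matrix_vector_mult_basis column_def)
    moreover have "continuous_on ?A (\<lambda>z. (frame_matrix z *v axis j 1) $ i)"
      using exhaust_4[of i] nz
      by (elim disjE) (simp_all add: frame_matrix_apply null_partner_def ipJ.scaleR_left ipJ.diff_left
          k\<^sub>0_def k\<^sub>1_def continuous_intros ip nrm d)
    ultimately show ?thesis by simp
  qed
  then have "continuous_on ?A (\<lambda>z. \<chi> i j. frame_matrix z $ i $ j)"
    by (intro continuous_on_vec_lambda)
  then show ?thesis by (simp only: vec_lambda_eta)
qed

text \<open>A smooth function comes with smooth local extensions off the jet space.  A function without
smoothness is extended by truncation: the value at \<open>z\<close> is the value at some jet in \<open>D\<close> that agrees
with \<open>z\<close> up to the order of the function, so the extension again has finite order.\<close>

lemma local_extension: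
  assumes "finite_order_on D f" "z \<in> D"
  obtains W h where "open W" "z \<in> W" "finite_order_on W h" "smooth_on_jets D f \<Longrightarrow> smooth_on W h"
    "\<And>w. w \<in> W \<Longrightarrow> w \<in> D \<Longrightarrow> h w = f w"
proof (cases "smooth_on_jets D f")
  case True
  then show ?thesis using assms(2) that unfolding smooth_on_jets_def by blast
next
  case False
  obtain N where N: "\<And>z w. z \<in> D \<Longrightarrow> w \<in> D \<Longrightarrow> \<forall>n\<le>N. z n = w n \<Longrightarrow> f z = f w"
    using assms(1) unfolding finite_order_on_def by blast
  define h where "h z = f (SOME w. w \<in> D \<and> (\<forall>n\<le>N. w n = z n))" for z
  show ?thesis
  proof (rule that[of UNIV h])
    show "finite_order_on UNIV h"
      unfolding finite_order_on_def
    proof (intro exI ballI impI)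
      fix z w :: jet assume "\<forall>n\<le>N. z n = w n"
      then have "(\<lambda>v. v \<in> D \<and> (\<forall>n\<le>N. v n = z n)) = (\<lambda>v. v \<in> D \<and> (\<forall>n\<le>N. v n = w n))"
        by auto
      then show "h z = h w" unfolding h_def by simp
    qed
    show "h w = f w" if "w \<in> D" for w
    proof -
      let ?P = "\<lambda>v. v \<in> D \<and> (\<forall>n\<le>N. v n = w n)"
      have "?P (SOME v. ?P v)" by (rule someI[of ?P w]) (simp add: that)
      then show ?thesis unfolding h_def using that by (intro N) auto
    qed
  qed (use False in auto)
qed

lemma normal_form_order: "\<exists>M. \<forall>\<kappa> \<kappa>'. (\<forall>m\<le>M. \<kappa> m = \<kappa>' m) \<longrightarrow> (\<forall>n\<le>N. normal_form \<kappa> n = normal_form \<kappa>' n)"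
proof -
  let ?A = "(\<lambda>(n, i). dorder (moving_jet n i)) ` ({..N} \<times> UNIV)"
  have "dorder (moving_jet n i) \<le> Max ?A" if "n \<le> N" for n i
    using that by (intro Max_ge) auto
  then have "normal_form \<kappa> n = normal_form \<kappa>' n"
    if "\<forall>m\<le>Max ?A. \<kappa> m = \<kappa>' m" "n \<le> N" for \<kappa> \<kappa>' n
    unfolding normal_form_def vec_eq_iff vec_lambda_beta using that
    by (intro allI dvalue_cong) (meson order_trans)
  then show ?thesis by blast
qed

lemma Cr_on_normal_form: "Cr_on r UNIV (\<lambda>\<kappa>. (G *v normal_form \<kappa> n) \<bullet> c)"
proof -
  have "(G *v normal_form \<kappa> n) \<bullet> c =
      (\<Sum>i\<in>UNIV. (\<Sum>j\<in>UNIV. G $ i $ j * dvalue (moving_jet n j) \<kappa>) * c $ i)" for \<kappa>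
    by (simp add: inner_vec_def matrix_vector_mult_def normal_form_def)
  then show ?thesis
    by (simp only:) (intro Cr_on_sum Cr_on_mult Cr_on_const Cr_on_dvalue open_UNIV)
qed

lemma prolong_nth: "prolong g z n = g *v z n"
  by (simp add: prolong_def)

lemma continuous_on_prolong:
  assumes "continuous_on A g"
  shows "continuous_on A (\<lambda>z. prolong (g z) z)"
proof (rule continuous_on_coordinatewise_then_product)
  fix n
  show "continuous_on A (\<lambda>z. prolong (g z) z n)"
    unfolding prolong_nth
    by (intro bounded_bilinear.continuous_on[OF bounded_bilinear_matrix_vector_mult]
        assms continuous_on_nth)
qed

lemma bounded_linear_matrix_matrix_mult:
  fixes G :: "real^'n^'m"
  shows "bounded_linear (\<lambda>A :: real^'k^'n. G ** A)"
  unfolding linear_conv_bounded_linear[symmetric]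
  by (rule linearI) (simp_all add: vec_eq_iff matrix_matrix_mult_def distrib_left sum.distrib
      sum_distrib_left mult.left_commute)

text \<open>Near the base jet \<open>z\<^sub>0\<close>, the element \<open>g z\<close> carries the jet \<open>z\<close> to the jet with the same invariants
whose frame is that of \<open>z\<^sub>0\<close>.  This jet is \<open>\<psi>\<close> of the invariants.  It is near \<open>z\<^sub>0\<close> by continuity of the
frame, and it is a jet of a curve in the cone because its point is the point of \<open>z\<^sub>0\<close>.\<close>

theorem differential_invariant_generated:
  assumes "differential_invariant D f"
  shows "functionally_generated D f"
  unfolding functionally_generated_def
proof
  fix z\<^sub>0 assume z0: "z\<^sub>0 \<in> D"
  obtain Q where Q: "open Q" "D = jet_space \<inter> Q"
    using assms by (auto simp: differential_invariant_def openin_open)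
  have order_f: "finite_order_on D f"
    using assms by (simp add: differential_invariant_def)
  obtain U\<^sub>1 V where U1: "open U\<^sub>1" "z\<^sub>0 \<in> U\<^sub>1" and V: "open V" "mat 1 \<in> V" and
    inv: "\<And>g z. g \<in> O31 \<inter> V \<Longrightarrow> z \<in> D \<inter> U\<^sub>1 \<Longrightarrow> prolong g z \<in> D \<Longrightarrow> f (prolong g z) = f z"
    using assms z0 unfolding differential_invariant_def by metis
  obtain W h where W: "open W" "z\<^sub>0 \<in> W" and h: "finite_order_on W h"
    "smooth_on_jets D f \<Longrightarrow> smooth_on W h" "\<And>w. w \<in> W \<Longrightarrow> w \<in> D \<Longrightarrow> h w = f w"
    using local_extension[OF order_f z0] by metis
  have "z\<^sub>0 \<in> jet_space" using z0 Q by simp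
  then obtain S\<^sub>0 u\<^sub>0 x\<^sub>0 where u0: "light_curve S\<^sub>0 u\<^sub>0" "x\<^sub>0 \<in> S\<^sub>0" "z\<^sub>0 = jet_of u\<^sub>0 x\<^sub>0"
    by (rule jet_spaceE)
  interpret base: light_curve S\<^sub>0 u\<^sub>0 by (rule u0)
  define G where "G = matrix_inv (frame_matrix z\<^sub>0)"
  have g0: "frame_matrix z\<^sub>0 \<in> O31" using base.R_O31 u0 by simp
  note G = O31_inv[OF g0, folded G_def]
  define g where "g z = G ** frame_matrix z" for z
  define \<Omega> where "\<Omega> = {z :: jet. ipJ (z 1) (z 1) > 0}"
  have "open \<Omega>"
    unfolding \<Omega>_def
    by (intro open_Collect_less continuous_on_const ipJ.continuous_on continuous_on_nth)
  have cg: "continuous_on \<Omega> g"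
    unfolding g_def \<Omega>_def
    by (rule bounded_linear.continuous_on[OF bounded_linear_matrix_matrix_mult
          continuous_on_frame_matrix])
  define U where "U = U\<^sub>1 \<inter> (\<Omega> \<inter> g -` V) \<inter> (\<Omega> \<inter> (\<lambda>z. prolong (g z) z) -` (Q \<inter> W))"
  have "open U"
    unfolding U_def using \<open>open \<Omega>\<close> U1 V W Q
    by (intro open_Int continuous_open_preimage cg continuous_on_prolong) auto
  moreover have "z\<^sub>0 \<in> U"
  proof -
    have "g z\<^sub>0 = mat 1" by (simp add: g_def G)
    moreover have "z\<^sub>0 \<in> \<Omega>"
      using base.cone_jet_jet_of u0 by (simp add: \<Omega>_def cone_jet_def)
    ultimately show ?thesis
      using U1 V W Q z0 by (simp add: U_def prolong_def)
  qed
  moreover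
  define \<psi> where "\<psi> \<kappa> = (\<lambda>n. G *v normal_form \<kappa> n)" for \<kappa>
  define W' where "W' = \<psi> -` W"
  obtain N where N: "\<And>z w. z \<in> W \<Longrightarrow> w \<in> W \<Longrightarrow> (\<And>n. n \<le> N \<Longrightarrow> z n = w n) \<Longrightarrow> h z = h w"
    using h(1) unfolding finite_order_on_def by metis
  have \<psi>: "Cr_on r UNIV (\<lambda>\<kappa>. \<psi> \<kappa> n \<bullet> c)" for r n c
    unfolding \<psi>_def by (rule Cr_on_normal_form)
  have "continuous_on UNIV \<psi>"
  proof (rule continuous_on_coordinatewise_then_product)
    fix n
    have "continuous_on UNIV (\<lambda>\<kappa>. \<Sum>c\<in>Basis. (\<psi> \<kappa> n \<bullet> c) *\<^sub>R c)"
      using \<psi>[THEN Cr_on_continuous]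
      by (intro continuous_on_sum continuous_on_scaleR continuous_on_const) simp
    then show "continuous_on UNIV (\<lambda>\<kappa>. \<psi> \<kappa> n)" by (simp add: euclidean_representation)
  qed
  then have W': "open W'"
    unfolding W'_def by (rule open_vimage[OF W(1)])
  moreover have "finite_order_on W' (\<lambda>\<kappa>. h (\<psi> \<kappa>))"
  proof -
    obtain M where M: "\<And>\<kappa> \<kappa>'. \<forall>m\<le>M. \<kappa> m = \<kappa>' m \<Longrightarrow> \<forall>n\<le>N. normal_form \<kappa> n = normal_form \<kappa>' n"
      using normal_form_order by metis
    show ?thesis
      unfolding finite_order_on_def
    proof (intro exI ballI impI)
      fix \<kappa> \<kappa>' assume "\<kappa> \<in> W'" "\<kappa>' \<in> W'" "\<forall>m\<le>M. \<kappa> m = \<kappa>' m"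
      then show "h (\<psi> \<kappa>) = h (\<psi> \<kappa>')"
        using M[of \<kappa> \<kappa>'] by (intro N) (simp_all add: W'_def \<psi>_def)
    qed
  qed
  moreover have "smooth_on W' (\<lambda>\<kappa>. h (\<psi> \<kappa>))" if "smooth_on_jets D f"
    unfolding smooth_on_def
  proof
    fix r
    show "Cr_on r W' (\<lambda>\<kappa>. h (\<psi> \<kappa>))"
    proof (rule Cr_on_compose[where \<phi> = \<psi> and h = h, OF W' W(1)])
      show "\<psi> ` W' \<subseteq> W" by (auto simp: W'_def)
      show "Cr_on r W' (\<lambda>\<kappa>. \<psi> \<kappa> m \<bullet> c)" for m c
        by (rule Cr_on_subset[OF \<psi>]) simp
      show "Cr_on r W h" using h(2)[OF that] by (simp add: smooth_on_def)
      show "h z = h w" if "z \<in> W" "w \<in> W" "\<And>n. n \<le> N \<Longrightarrow> z n = w n" for z w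
        using that by (rule N)
    qed
  qed
  moreover have "invariant_jet u x \<in> W' \<and> f (jet_of u x) = h (\<psi> (invariant_jet u x))"
    if u: "nonradial_curve S u" "x \<in> S" and zU: "jet_of u x \<in> D \<inter> U" for S u x
  proof -
    interpret light_curve S u using u(1) by unfold_locales
    let ?z = "jet_of u x"
    have gz: "prolong (g ?z) ?z = \<psi> (invariant_jet u x)"
      unfolding \<psi>_def frame_times_jet_eq_normal_form[OF u(2), symmetric]
      by (simp add: prolong_def g_def jet_of_nth fun_eq_iff flip: matrix_vector_mul_assoc)
    have gO: "g ?z \<in> O31" unfolding g_def by (intro O31_mult G R_O31 u)
    have zU': "?z \<in> U\<^sub>1" "g ?z \<in> V" "prolong (g ?z) ?z \<in> Q" "prolong (g ?z) ?z \<in> W"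
      using zU by (auto simp: U_def)
    \<comment> \<open>Both frames send the point of their curve to \<open>e\<^sub>4\<close>, so the moved curve passes through the base point.\<close>
    have "g ?z *v u x = u\<^sub>0 x\<^sub>0"
    proof -
      have "R x *v u x = axis 4 1" "frame_matrix z\<^sub>0 *v u\<^sub>0 x\<^sub>0 = axis 4 1"
        using frame_on_jet(1)[OF cone_jet_jet_of is_frame_R, OF u(2) u(2)]
          frame_on_jet(1)[OF base.cone_jet_jet_of base.is_frame_R, OF u0(2) u0(2)]
        by (simp_all add: jet_of_nth nderiv_0 u0(3))
      then show ?thesis
        unfolding g_def matrix_vector_mul_assoc[symmetric] by (metis G(4))
    qed
    moreover have "u\<^sub>0 x\<^sub>0 \<in> upper_light_cone" "u\<^sub>0 x\<^sub>0 $ 4 \<noteq> 0"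
      using base.nonradial u0(2) by (auto simp: nonradial_curve_def)
    ultimately have "prolong (g ?z) ?z \<in> jet_space"
      using prolong_in_jet_space[OF u(2) gO] by (simp add: upper_light_cone_def)
    then have gD: "prolong (g ?z) ?z \<in> D" using Q zU' by simp
    have "f ?z = f (prolong (g ?z) ?z)"
      using inv[of "g ?z" ?z] gO zU zU' gD by simp
    also have "\<dots> = h (prolong (g ?z) ?z)"
      using h(3) zU' gD by simp
    finally show ?thesis
      using zU' unfolding gz by (simp add: W'_def)
  qed
  ultimately show "\<exists>U W F. open U \<and> z\<^sub>0 \<in> U \<and> open W \<and> finite_order_on W F \<and>
      (smooth_on_jets D f \<longrightarrow> smooth_on W F) \<and>
      (\<forall>S u x. nonradial_curve S u \<longrightarrow> x \<in> S \<longrightarrow> jet_of u x \<in> D \<inter> U \<longrightarrow>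
         invariant_jet u x \<in> W \<and> f (jet_of u x) = F (invariant_jet u x))"
    by (intro exI[of _ U] exI[of _ W'] exI[of _ "\<lambda>\<kappa>. h (\<psi> \<kappa>)"]) simp
qed

theorem theorem3p2:
  shows "(\<forall>S u. nonradial_curve S u \<longrightarrow> (\<forall>x\<in>S.
            \<rho>\<^sub>L u differentiable (at x) \<and>
            (let k0 = k\<^sub>0 (jet_of u x); k1 = k\<^sub>1 (jet_of u x); k2 = k\<^sub>2 (jet_of u x) in
             right_maurer_cartan (\<rho>\<^sub>L u) x =
               vector [vector [  0, -k0,   0,   0],
                       vector [-k1,   0,   0, -k0],
                       vector [-k2,   0,   0,   0],
                       vector [  0, -k1, -k2,   0]])))
       \<and> differential_invariant jet_space k\<^sub>0
       \<and> differential_invariant jet_space k\<^sub>1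
       \<and> differential_invariant jet_space k\<^sub>2
       \<and> (\<forall>D f. differential_invariant D f \<longrightarrow> functionally_generated D f)"
proof (intro conjI allI impI ballI)
  fix S u x assume "nonradial_curve S u" and x: "x \<in> S"
  then interpret light_curve S u by unfold_locales
  show "\<rho>\<^sub>L u differentiable (at x)" by (rule moving_frame_of_curve(1)[OF x])
  show "let k0 = k\<^sub>0 (jet_of u x); k1 = k\<^sub>1 (jet_of u x); k2 = k\<^sub>2 (jet_of u x) in
      right_maurer_cartan (\<rho>\<^sub>L u) x =
        vector [vector [  0, -k0,   0,   0],
                vector [-k1,   0,   0, -k0],
                vector [-k2,   0,   0,   0],
                vector [  0, -k1, -k2,   0]]"
    unfolding Let_def using moving_frame_of_curve(2)[OF x] by (simp only: mc_matrix_def)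
qed (simp_all only: differential_invariants differential_invariant_generated)

end
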